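(* Let $(\mathcal M,\rho)$ be a finite pseudometric space, and let $F$ be a set-valued mapping assigning to each $x\in\mathcal M$ a nonempty convex closed set $F(x)\subset\mathbb R^2$. Let $\tilde\lambda,\lambda\ge0$, and assume that for every $x,x',x'',y,y',y''\in\mathcal M$ $$\mathcal W_F[x,x',x'':\tilde\lambda]\cap\{\mathcal W_F[y,y',y'':\tilde\lambda]+\lambda\,\rho(x,y)\,Q_0\}\ne\emptyset .$$ Then $F$ has a Lipschitz selection with Lipschitz seminorm at most $2\lambda+\tilde\lambda$.
   Context: A pseudometric on $\mathcal M$ is a function $\rho:\mathcal M\times\mathcal M\to[0,+\infty]$ with $\rho(x,x)=0$, $\rho(x,y)=\rho(y,x)$ and $\rho(x,y)\le\rho(x,z)+\rho(z,y)$ (zero distance between distinct points and the value $+\infty$ are allowed); "finite pseudometric space" means $\mathcal M$ is finite. $\|\cdot\|$ is the uniform norm on $\mathbb R^2$, $Q_0=[-1,1]^2$, $A+B$ is the Minkowski sum (so $\emptyset+B=\emptyset$). If $\rho(x,y)=+\infty$ then for every $\lambda\ge0$, $A+\lambda\rho(x,y)Q_0=\mathbb R^2$ for nonempty $A$ (and $=\emptyset$ for $A=\emptyset$), and the inequality $\|f(x)-f(y)\|\le\lambda\rho(x,y)$ is no constraint. For $f:\mathcal M\to\mathbb R^2$, $\|f\|_{\mathrm{Lip}(\mathcal M)}=\inf\{\lambda\ge0:\|f(x)-f(y)\|\le\lambda\rho(x,y)\ \forall x,y\in\mathcal M\}$ is its Lipschitz seminorm; a Lipschitz selection of $F$ is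 a map $f:\mathcal M\to\mathbb R^2$ with $f(x)\in F(x)$ for all $x$ and finite Lipschitz seminorm. A rectangle is a set $I_1\times I_2$ with $I_1,I_2\subset\mathbb R$ nonempty closed intervals (points and unbounded intervals allowed). For a nonempty convex $S\subset\mathbb R^2$, $\mathcal H[S]$ is the smallest closed rectangle containing $S$; $\mathcal H[\emptyset]=\emptyset$. For $\lambda\ge0$ and $x,x',x''\in\mathcal M$, $$\mathcal W_F[x,x',x'':\lambda]=\mathcal H\big[\{F(x')+\lambda\rho(x',x)Q_0\}\cap\{F(x'')+\lambda\rho(x'',x)Q_0\}\big].$$ *)

theory Defs
  imports "HOL-Analysis.Analysis" "HOL-Library.Set_Algebras"
begin

text \<open>The plane is \<^typ>\<open>real \<times> real\<close>, its uniform norm is \<^const>\<open>infnorm\<close>, and \<open>A + B\<close> on sets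
  is the Minkowski sum of \<^theory>\<open>HOL-Library.Set_Algebras\<close>. A set \<open>M\<close> of points is a subset of
  an arbitrary type; functions on \<open>M\<close> are total functions of which only the values on \<open>M\<close> matter.\<close>

lemma infnorm_plane: "infnorm (a, b) = max \<bar>a\<bar> \<bar>b :: real\<bar>" for a :: real
  by (simp add: infnorm_Max Basis_prod_def)

definition pseudometric_on :: "'a set \<Rightarrow> ('a \<Rightarrow> 'a \<Rightarrow> ennreal) \<Rightarrow> bool" where
  "pseudometric_on M \<rho> \<longleftrightarrow>
     (\<forall>x\<in>M. \<rho> x x = 0) \<and>
     (\<forall>x\<in>M. \<forall>y\<in>M. \<rho> x y = \<rho> y x) \<and>
     (\<forall>x\<in>M. \<forall>y\<in>M. \<forall>z\<in>M. \<rho> x y \<le> \<rho> x z + \<rho> z y)"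

definition unit_square :: "(real \<times> real) set" where
  "unit_square = {-1..1} \<times> {-1..1}"

text \<open>\<open>scaled_square l r\<close> is \<open>l r Q\<^sub>0\<close>. For \<open>r = \<infinity>\<close> it is the whole plane, also when \<open>l = 0\<close>
  (whereas \<open>0 * \<infinity> = 0\<close> in \<^typ>\<open>ennreal\<close>); the Minkowski sum of the plane with \<open>A\<close> is then
  the plane if \<open>A\<close> is nonempty, and empty otherwise.\<close>

definition scaled_square :: "real \<Rightarrow> ennreal \<Rightarrow> (real \<times> real) set" where
  "scaled_square l r =
     (if r = \<infinity> then UNIV else (\<lambda>p. (l * enn2real r) *\<^sub>R p) ` unit_square)"

definition rectangle :: "(real \<times> real) set \<Rightarrow> bool" where
  "rectangle R \<longleftrightarrow>
     (\<exists>I J. is_interval I \<and> closed I \<and> I \<noteq> {} \<and> is_interval J \<and> closed J \<and> J \<noteq> {} \<and> R = I \<times> J)"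

definition rectangular_hull :: "(real \<times> real) set \<Rightarrow> (real \<times> real) set" where
  "rectangular_hull S = (if S = {} then {} else rectangle hull S)"

lemma rectangle_hull_smallest:
  assumes "S \<noteq> {}"
  shows "rectangle (rectangle hull S)" "S \<subseteq> rectangle hull S"
    "\<And>R. rectangle R \<Longrightarrow> S \<subseteq> R \<Longrightarrow> rectangle hull S \<subseteq> R"
proof -
  show "S \<subseteq> rectangle hull S"
    by (rule hull_subset)
  show "rectangle hull S \<subseteq> R" if "rectangle R" "S \<subseteq> R" for R
    using that by (intro hull_minimal)
  define C where "C = {(I, J). is_interval I \<and> closed I \<and> is_interval J \<and> closed J \<and> S \<subseteq> I \<times> J}"
  obtain a b where ab: "(a, b) \<in> S"
    using assms by auto
  have C_iff: "rectangle R \<and> S \<subseteq> R \<longleftrightarrow> R \<in> (\<lambda>(I, J). I \<times> J) ` C" for R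
    using ab unfolding rectangle_def C_def by fastforce
  define I where "I = \<Inter> (fst ` C)"
  define J where "J = \<Inter> (snd ` C)"
  have univ: "(UNIV, UNIV) \<in> C"
    by (simp add: C_def)
  have "rectangle hull S = (\<Inter>c\<in>C. fst c \<times> snd c)"
    unfolding hull_def C_iff by (auto simp: case_prod_beta)
  also have "\<dots> = I \<times> J"
    using univ by (auto simp: I_def J_def)
  finally have eq: "rectangle hull S = I \<times> J" .
  have "a \<in> I" "b \<in> J"
    using ab by (auto simp: I_def J_def C_def)
  moreover have "closed I" "closed J"
    by (auto simp: I_def J_def C_def intro!: closed_Inter)
  moreover have "is_interval I" "is_interval J"
    by (auto simp: I_def J_def C_def is_interval_convex_1 intro!: convex_Inter)
  ultimately show "rectangle (rectangle hull S)"
    unfolding rectangle_def eq by blast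
qed

definition W ::
  "('a \<Rightarrow> 'a \<Rightarrow> ennreal) \<Rightarrow> ('a \<Rightarrow> (real \<times> real) set) \<Rightarrow> real \<Rightarrow> 'a \<Rightarrow> 'a \<Rightarrow> 'a \<Rightarrow> (real \<times> real) set"
  where
  "W \<rho> F l x x' x'' =
     rectangular_hull
       ((F x' + scaled_square l (\<rho> x' x)) \<inter> (F x'' + scaled_square l (\<rho> x'' x)))"

text \<open>The infimum is taken in \<^typ>\<open>ennreal\<close>, so it is \<open>\<infinity>\<close> if no constant is admissible.\<close>

definition lip_seminorm ::
  "'a set \<Rightarrow> ('a \<Rightarrow> 'a \<Rightarrow> ennreal) \<Rightarrow> ('a \<Rightarrow> real \<times> real) \<Rightarrow> ennreal" where
  "lip_seminorm M \<rho> f =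
     Inf {ennreal l |l. 0 \<le> l \<and>
       (\<forall>x\<in>M. \<forall>y\<in>M. \<rho> x y \<noteq> \<infinity> \<longrightarrow> infnorm (f x - f y) \<le> l * enn2real (\<rho> x y))}"

definition lipschitz_selection ::
  "'a set \<Rightarrow> ('a \<Rightarrow> 'a \<Rightarrow> ennreal) \<Rightarrow> ('a \<Rightarrow> (real \<times> real) set) \<Rightarrow> ('a \<Rightarrow> real \<times> real) \<Rightarrow> bool"
  where
  "lipschitz_selection M \<rho> F f \<longleftrightarrow> (\<forall>x\<in>M. f x \<in> F x) \<and> lip_seminorm M \<rho> f < \<infinity>"

end

theory Submission
  imports Defs
begin

text \<open>
  Write \<open>K\<^sub>u(x) = F(u) + lamt \<rho>(u, x) Q\<^sub>0\<close> and let \<open>R(x)\<close> be the intersection of the \<open>K\<^sub>u(x)\<close>. The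
  hypothesis makes the intersections of the rectangles \<open>W[x, x', x'']\<close> over \<open>x', x''\<close> admit a
  selection \<open>a\<close> with constant \<open>lam\<close>, one coordinate at a time. By Helly's theorem on vertical and
  horizontal lines, \<open>a(x)\<close> lies in the rectangular hull of \<open>R(x)\<close>; if the projections are not
  closed, a recession argument replaces the line through \<open>a(x)\<close> by nearby ones.

  Because of this, the nearest point of \<open>R(x)\<close> to \<open>a(x)\<close> in the uniform norm has the form
  \<open>f(x) = a(x) + \<delta> s\<close> with signs \<open>s\<close>, and \<open>\<delta>\<close> is determined by the sets \<open>K\<^sub>u(x)\<close> enlarged by the
  quadrant of \<open>s\<close>. Unlike \<open>R(x)\<close>, the intersection of these enlarged sets changes by at most a shift
  along \<open>s\<close> of size \<open>lamt \<rho>(x, y)\<close> when \<open>x\<close> is replaced by \<open>y\<close>. Hence \<open>\<delta>\<close> changes by at most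
  \<open>(lam + lamt) \<rho>(x, y)\<close>, and where the signs at \<open>x\<close> and \<open>y\<close> differ, even the sum of both \<open>\<delta>\<close> is at
  most this.
\<close>

section \<open>One-dimensional Lipschitz selections and level points on segments\<close>

text \<open>A McShane-type envelope of lower endpoints is Lipschitz, and the pairwise condition
  keeps it below some point of each interval. \<open>E i j\<close> says that the distance
  \<open>d i j\<close> is finite. With \<open>d = 0\<close> and \<open>E\<close> true this is
  Helly's theorem on the line.\<close>

lemma interval_selection:
  fixes I :: "'b \<Rightarrow> real set" and d :: "'b \<Rightarrow> 'b \<Rightarrow> real"
  assumes fin: "finite A"
    and conv: "\<And>i. i \<in> A \<Longrightarrow> convex (I i)"
    and refl: "\<And>i. i \<in> A \<Longrightarrow> E i i \<and> d i i = 0"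
    and sym: "\<And>i j. i \<in> A \<Longrightarrow> j \<in> A \<Longrightarrow> E i j \<Longrightarrow> E j i \<and> d j i = d i j"
    and tri: "\<And>i j k. \<lbrakk>i \<in> A; j \<in> A; k \<in> A; E i j; E j k\<rbrakk> \<Longrightarrow> E i k \<and> d i k \<le> d i j + d j k"
    and meet: "\<And>i j. i \<in> A \<Longrightarrow> j \<in> A \<Longrightarrow> \<exists>p\<in>I i. \<exists>q\<in>I j. E i j \<longrightarrow> \<bar>p - q\<bar> \<le> d i j"
  shows "\<exists>g. (\<forall>i\<in>A. g i \<in> I i) \<and> (\<forall>i\<in>A. \<forall>j\<in>A. E i j \<longrightarrow> \<bar>g i - g j\<bar> \<le> d i j)"
proof -
  obtain P Q where PQ: "\<And>i j. i \<in> A \<Longrightarrow> j \<in> A \<Longrightarrow> P i j \<in> I i \<and> Q i j \<in> I j \<and> (E i j \<longrightarrow> \<bar>P i j - Q i j\<bar> \<le> d i j)"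
    using meet by metis
  \<comment> \<open>The witnesses in \<open>I i\<close> form a finite set whose minimum can replace
    the infimum of \<open>I i\<close>, which may be infinite or not attained.\<close>
  define X where "X i = P i ` A \<union> (\<lambda>j. Q j i) ` A" for i
  have X: "finite (X i)" "X i \<noteq> {}" "X i \<subseteq> I i" if "i \<in> A" for i
    using fin that PQ by (auto simp: X_def)
  define l where "l i = Min (X i)" for i
  \<comment> \<open>The smallest function that is Lipschitz for \<open>d\<close> and lies above
    \<open>l\<close>.\<close>
  define g where "g i = Max ((\<lambda>j. l j - d i j) ` {j \<in> A. E i j})" for i
  have g_attained: "\<exists>j\<in>A. E i j \<and> g i = l j - d i j" if "i \<in> A" for i
  proof -
    have "g i \<in> (\<lambda>j. l j - d i j) ` {j \<in> A. E i j}"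
      unfolding g_def using fin refl that by (intro Max_in) auto
    then show ?thesis by auto
  qed
  have g_ge: "l j - d i j \<le> g i" if "i \<in> A" "j \<in> A" "E i j" for i j
    unfolding g_def using fin that by (intro Max_ge) auto
  have lip: "g i - g j \<le> d i j" if ij: "i \<in> A" "j \<in> A" "E i j" for i j
  proof -
    obtain k where k: "k \<in> A" "E i k" "g i = l k - d i k"
      using g_attained ij by blast
    have "E j k \<and> d j k \<le> d j i + d i k" "d j i = d i j"
      using tri[of j i k] sym[of i j] ij k by auto
    with g_ge[of j k] ij k show ?thesis by auto
  qed
  have "g i \<in> I i" if i: "i \<in> A" for i
  proof -
    obtain j where j: "j \<in> A" "E i j" "g i = l j - d i j"
      using g_attained i by blast
    have ji: "E j i" "d j i = d i j"
      using sym i j by auto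
    \<comment> \<open>The witness pair for \<open>j\<close> and \<open>i\<close> gives
      \<open>g i \<le> P j i - d i j \<le> Q j i\<close>, so \<open>g i\<close> lies between the
      points \<open>l i\<close> and \<open>Q j i\<close> of \<open>I i\<close>.\<close>
    have "l j \<le> P j i"
      unfolding l_def using X i j by (intro Min_le) (auto simp: X_def)
    then have le: "g i \<le> Q j i"
      using PQ[of j i] i j ji by auto
    have ge: "l i \<le> g i"
      using g_ge[of i i] refl i by auto
    have "l i \<in> I i"
      using X[OF i] Min_in[of "X i"] unfolding l_def by blast
    then show ?thesis
      using conv[OF i] le ge PQ[of j i] i j
      by (meson convex_contains_segment mem_is_interval_1_I is_interval_convex_1)
  qed
  moreover have "\<bar>g i - g j\<bar> \<le> d i j" if "i \<in> A" "j \<in> A" "E i j" for i j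
    using lip[of i j] lip[of j i] sym[of i j] that by auto
  ultimately show ?thesis by blast
qed

text \<open>Either an endpoint already lies in the band of width \<open>\<epsilon>\<close>, or
  \<open>f\<close> changes sign along the segment and linear interpolation finds a zero. The
  parameter \<open>t\<close> is exposed so that further coordinates of the point can be estimated as
  convex combinations.\<close>

lemma convex_level:
  assumes C: "convex C" "p \<in> C" "q \<in> C" and eps: "0 \<le> \<epsilon>"
    and aff: "\<And>t. f ((1 - t) *\<^sub>R p + t *\<^sub>R q) = (1 - t) * f p + t * f q"
    and f: "f p \<le> \<epsilon>" "- \<epsilon> \<le> f q"
  shows "\<exists>t. 0 \<le> t \<and> t \<le> 1 \<and> (1 - t) *\<^sub>R p + t *\<^sub>R q \<in> C \<and> \<bar>f ((1 - t) *\<^sub>R p + t *\<^sub>R q) :: real\<bar> \<le> \<epsilon>"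
proof -
  have mem: "(1 - t) *\<^sub>R p + t *\<^sub>R q \<in> C" if "0 \<le> t" "t \<le> 1" for t
    using C that by (auto simp: convex_alt)
  consider "- \<epsilon> \<le> f p" | "f q \<le> \<epsilon>" | "f p < 0" "0 < f q"
    using eps by linarith
  then show ?thesis
  proof cases
    case 1
    with f mem[of 0] show ?thesis by (intro exI[of _ 0]) auto
  next
    case 2
    with f mem[of 1] show ?thesis by (intro exI[of _ 1]) auto
  next
    case 3
    define t where "t = f p / (f p - f q)"
    have t: "0 \<le> t" "t \<le> 1"
      using 3 by (auto simp: t_def field_simps)
    have "(1 - t) * f p + t * f q = 0"
      using 3 by (simp add: t_def divide_simps)
    with t mem[of t] eps show ?thesis
      by (intro exI[of _ t]) (simp add: aff)
  qed
qed

lemma convex_zero: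
  assumes "convex C" "p \<in> C" "q \<in> C"
    and "\<And>t. f ((1 - t) *\<^sub>R p + t *\<^sub>R q) = (1 - t) * f p + t * f q"
    and "f p \<le> 0" "0 \<le> f q"
  shows "\<exists>v\<in>C. f v = (0 :: real)"
proof -
  obtain t where "(1 - t) *\<^sub>R p + t *\<^sub>R q \<in> C" "\<bar>f ((1 - t) *\<^sub>R p + t *\<^sub>R q)\<bar> \<le> 0"
    using convex_level[of C p q 0 f] assms by auto
  then show ?thesis by auto
qed

lemma convex_comb_le:
  fixes t :: real
  assumes "0 \<le> t" "t \<le> 1" "x \<le> b" "y \<le> b"
  shows "(1 - t) * x + t * y \<le> b"
  using convex_bound_le[of x b y "1 - t" t] assms by simp

lemma convex_comb_ge:
  fixes t :: real
  assumes "0 \<le> t" "t \<le> 1" "b \<le> x" "b \<le> y"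
  shows "b \<le> (1 - t) * x + t * y"
  using convex_comb_le[of t "-x" "-b" "-y"] assms by simp

subsection \<open>Finite intersections of convex sets near a vertical line\<close>

text \<open>The part of \<open>C\<close> in a bounded box has a compact projection avoiding
  \<open>a\<close>, so points of \<open>C\<close> close to the line are vertically far away. By
  convexity they cannot go both up and down without crossing height 0 near the line.\<close>

lemma escape_from_line:
  fixes C :: "(real \<times> real) set"
  assumes C: "closed C" "convex C" and miss: "\<And>z. z \<in> C \<Longrightarrow> fst z \<noteq> a"
  shows "\<exists>\<sigma>\<in>{1, -1}. \<forall>N. \<exists>\<eta>>0. \<forall>z\<in>C. \<bar>fst z - a\<bar> < \<eta> \<longrightarrow> N < \<sigma> * snd z"
proof -
  have far: "\<exists>\<eta>>0. \<forall>z\<in>C. \<bar>fst z - a\<bar> < \<eta> \<longrightarrow> N < \<bar>snd z\<bar>" for N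
  proof -
    let ?B = "{a - 1..a + 1} \<times> {- N..N}"
    have "compact (C \<inter> ?B)"
      using C by (intro closed_Int_compact compact_Times) auto
    then have "closed (fst ` (C \<inter> ?B))"
      by (intro compact_imp_closed compact_continuous_image continuous_intros)
    moreover have "a \<notin> fst ` (C \<inter> ?B)"
      using miss by blast
    ultimately obtain e where e: "e > 0" "ball a e \<subseteq> - fst ` (C \<inter> ?B)"
      by (metis open_contains_ball open_Compl ComplI)
    have "N < \<bar>snd z\<bar>" if "z \<in> C" "\<bar>fst z - a\<bar> < min e 1" for z
    proof (rule ccontr)
      assume "\<not> N < \<bar>snd z\<bar>"
      then have "z \<in> C \<inter> ?B"
        using that by (auto simp: mem_Times_iff abs_le_iff)
      then have "fst z \<notin> ball a e"
        using e by blast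
      then show False
        using that by (auto simp: dist_real_def)
    qed
    then show ?thesis
      using e(1) by (intro exI[of _ "min e 1"]) auto
  qed
  \<comment> \<open>In the strip of width \<open>\<eta>0\<close> no point of \<open>C\<close> has
    height 0, hence the height has a constant sign there.\<close>
  obtain \<eta>0 where \<eta>0: "\<eta>0 > 0" "\<And>z. z \<in> C \<Longrightarrow> \<bar>fst z - a\<bar> < \<eta>0 \<Longrightarrow> snd z \<noteq> 0"
    using far[of 0] by auto
  define C0 where "C0 = C \<inter> {a - \<eta>0<..<a + \<eta>0} \<times> UNIV"
  have C0: "convex C0"
    unfolding C0_def using C by (intro convex_Int convex_Times) auto
  have nz: "snd z \<noteq> 0" if "z \<in> C0" for z
    using \<eta>0(2)[of z] that by (auto simp: C0_def mem_Times_iff abs_less_iff)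
  have "\<not> (p \<in> C0 \<and> q \<in> C0 \<and> snd p \<le> 0 \<and> 0 \<le> snd q)" for p q
  proof
    assume "p \<in> C0 \<and> q \<in> C0 \<and> snd p \<le> 0 \<and> 0 \<le> snd q"
    then have "\<exists>v\<in>C0. snd v = 0"
      by (intro convex_zero[OF C0, of p q]) auto
    with nz show False by blast
  qed
  then have "(\<forall>z\<in>C0. 0 < snd z) \<or> (\<forall>z\<in>C0. snd z < 0)"
    by (meson linear not_le)
  then obtain \<sigma> :: real where \<sigma>: "\<sigma> \<in> {1, -1}" "\<And>z. z \<in> C0 \<Longrightarrow> 0 < \<sigma> * snd z"
    by (metis insertI1 insertI2 mult_1 mult_minus1 neg_0_less_iff_less singletonI)
  have "\<exists>\<eta>>0. \<forall>z\<in>C. \<bar>fst z - a\<bar> < \<eta> \<longrightarrow> N < \<sigma> * snd z" for N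
  proof -
    obtain \<eta> where \<eta>: "\<eta> > 0" "\<And>z. z \<in> C \<Longrightarrow> \<bar>fst z - a\<bar> < \<eta> \<Longrightarrow> N < \<bar>snd z\<bar>"
      using far[of N] by auto
    have "N < \<sigma> * snd z" if "z \<in> C" "\<bar>fst z - a\<bar> < min \<eta> \<eta>0" for z
    proof -
      have "z \<in> C0"
        using that by (auto simp: C0_def mem_Times_iff abs_less_iff)
      then show ?thesis
        using \<sigma>(1) \<sigma>(2)[of z] \<eta>(2)[of z] that by auto
    qed
    with \<eta> \<eta>0 show ?thesis
      by (intro exI[of _ "min \<eta> \<eta>0"]) auto
  qed
  with \<sigma>(1) show ?thesis by blast
qed

text \<open>The segment from \<open>(a, h)\<close> to a far point of \<open>K\<close> near the line
  crosses the height \<open>h'\<close> close to \<open>(a, h')\<close>; closedness does the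
  rest.\<close>

lemma ray_in_closed_convex:
  fixes K :: "(real \<times> real) set"
  assumes K: "closed K" "convex K" and h: "(a, h) \<in> K"
    and esc: "\<And>N \<eta>. \<eta> > 0 \<Longrightarrow> \<exists>z\<in>K. \<bar>fst z - a\<bar> < \<eta> \<and> N < \<sigma> * snd z"
    and \<sigma>: "\<sigma> \<in> {1, -1}" and h': "\<sigma> * h \<le> \<sigma> * h'"
  shows "(a, h') \<in> K"
proof (rule ccontr)
  assume "(a, h') \<notin> K"
  then obtain e where e: "e > 0" "ball (a, h') e \<subseteq> - K"
    using K by (metis open_contains_ball open_Compl ComplI)
  obtain z where z: "z \<in> K" "\<bar>fst z - a\<bar> < e" "\<sigma> * h' < \<sigma> * snd z"
    using esc[OF e(1)] by blast
  let ?v = "\<lambda>t. (1 - t) *\<^sub>R (a, h) + t *\<^sub>R z"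
  obtain t where t: "0 \<le> t" "t \<le> 1" "?v t \<in> K" "\<bar>\<sigma> * (snd (?v t) - h')\<bar> \<le> 0"
    using convex_level[OF K(2) h z(1), of 0 "\<lambda>v. \<sigma> * (snd v - h')"] z h'
    by (auto simp: algebra_simps)
  have "snd (?v t) = h'"
    using t(4) \<sigma> by auto
  moreover have "\<bar>fst (?v t) - a\<bar> < e"
  proof -
    have "fst (?v t) - a = t * (fst z - a)"
      by (simp add: algebra_simps)
    moreover have "t * \<bar>fst z - a\<bar> \<le> \<bar>fst z - a\<bar>"
      using t by (simp add: mult_left_le_one_le)
    ultimately show ?thesis
      using z t by (simp add: abs_mult)
  qed
  ultimately have "?v t \<in> ball (a, h') e"
    by (simp add: dist_prod_def dist_real_def abs_minus_commute)
  with e t show False by blast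
qed

text \<open>If all pairs meet on the line over \<open>a\<close>, one-dimensional Helly gives a
  common point there. Otherwise some \<open>K m\<close> misses the line, and each \<open>K i\<close>
  contains points of \<open>K m\<close> that go to infinity along it in the direction
  \<open>\<sigma>\<close>. On a nearby parallel line every \<open>K i\<close> then reaches
  arbitrarily far in that direction, so all of them share a point.\<close>

lemma inter_meets_lines_near:
  fixes K :: "'b \<Rightarrow> (real \<times> real) set"
  assumes fin: "finite I"
    and K: "\<And>i. i \<in> I \<Longrightarrow> closed (K i) \<and> convex (K i)"
    and cl: "\<And>i j. i \<in> I \<Longrightarrow> j \<in> I \<Longrightarrow> a \<in> closure (fst ` (K i \<inter> K j))"
    and \<epsilon>: "\<epsilon> > 0"
  shows "\<exists>z\<in>\<Inter>(K ` I). \<bar>fst z - a\<bar> < \<epsilon>"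
proof (cases "\<forall>i\<in>I. \<forall>j\<in>I. \<exists>y. (a, y) \<in> K i \<inter> K j")
  case True
  define J where "J i = {y. (a, y) \<in> K i}" for i
  have J: "convex (J i)" if "i \<in> I" for i
    unfolding convex_alt
  proof (intro ballI allI impI)
    fix x y u :: real
    assume "x \<in> J i" "y \<in> J i" "0 \<le> u \<and> u \<le> 1"
    then have "(1 - u) *\<^sub>R (a, x) + u *\<^sub>R (a, y) \<in> K i"
      using K[OF that] unfolding J_def convex_alt by blast
    moreover have "(1 - u) *\<^sub>R (a, x) + u *\<^sub>R (a, y) = (a, (1 - u) *\<^sub>R x + u *\<^sub>R y)"
      by (simp add: algebra_simps)
    ultimately show "(1 - u) *\<^sub>R x + u *\<^sub>R y \<in> J i"
      by (simp add: J_def)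
  qed
  \<comment> \<open>Distance zero between all indices forces the selected heights to
    coincide.\<close>
  have "\<exists>g. (\<forall>i\<in>I. g i \<in> J i) \<and> (\<forall>i\<in>I. \<forall>j\<in>I. True \<longrightarrow> \<bar>g i - g j\<bar> \<le> (0 :: real))"
    using True by (intro interval_selection fin J) (fastforce simp: J_def)+
  then obtain g where g: "\<And>i. i \<in> I \<Longrightarrow> g i \<in> J i" "\<And>i j. i \<in> I \<Longrightarrow> j \<in> I \<Longrightarrow> \<bar>g i - g j\<bar> \<le> 0"
    by blast
  have "\<exists>c. \<forall>i\<in>I. g i = c"
    using g(2) by (metis abs_le_zero_iff eq_iff_diff_eq_0)
  then obtain c where "\<forall>i\<in>I. g i = c"
    by blast
  then have "(a, c) \<in> \<Inter>(K ` I)"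
    using g(1) by (auto simp: J_def)
  with \<epsilon> show ?thesis by force
next
  case False
  have near: "\<exists>z\<in>K i \<inter> K j. \<bar>fst z - a\<bar> < \<eta>" if "i \<in> I" "j \<in> I" "\<eta> > 0" for i j \<eta>
    using cl[OF that(1,2)] that(3) by (auto simp: closure_approachable dist_real_def)
  obtain i0 j0 where i0: "i0 \<in> I" "j0 \<in> I" "\<And>y. (a, y) \<notin> K i0 \<inter> K j0"
    using False by blast
  \<comment> \<open>If both sets met the line, both would contain a vertical ray of it, in the same direction.\<close>
  have "(\<forall>y. (a, y) \<notin> K i0) \<or> (\<forall>y. (a, y) \<notin> K j0)"
  proof (rule ccontr)
    assume "\<not> ?thesis"
    then obtain h1 h2 where h: "(a, h1) \<in> K i0" "(a, h2) \<in> K j0" by blast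
    have "closed (K i0 \<inter> K j0)" "convex (K i0 \<inter> K j0)" "\<And>z. z \<in> K i0 \<inter> K j0 \<Longrightarrow> fst z \<noteq> a"
      using K i0 by (auto intro!: closed_Int convex_Int)
    from escape_from_line[OF this] obtain \<sigma> :: real where \<sigma>: "\<sigma> \<in> {1, -1}"
      "\<And>N. \<exists>\<eta>>0. \<forall>z\<in>K i0 \<inter> K j0. \<bar>fst z - a\<bar> < \<eta> \<longrightarrow> N < \<sigma> * snd z"
      by blast
    have esc: "\<exists>z\<in>K i0 \<inter> K j0. \<bar>fst z - a\<bar> < \<eta> \<and> N < \<sigma> * snd z" if "\<eta> > 0" for N \<eta>
    proof -
      obtain \<eta>' where "\<eta>' > 0" "\<forall>z\<in>K i0 \<inter> K j0. \<bar>fst z - a\<bar> < \<eta>' \<longrightarrow> N < \<sigma> * snd z"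
        using \<sigma>(2) by blast
      with near[OF i0(1,2), of "min \<eta> \<eta>'"] that show ?thesis by auto
    qed
    define h where "h = (if \<sigma> * h1 \<le> \<sigma> * h2 then h2 else h1)"
    have h_ge: "\<sigma> * h1 \<le> \<sigma> * h" "\<sigma> * h2 \<le> \<sigma> * h"
      by (auto simp: h_def)
    have cc: "closed (K i0)" "convex (K i0)" "closed (K j0)" "convex (K j0)"
      using K i0 by auto
    have "\<exists>z\<in>K i0. \<bar>fst z - a\<bar> < \<eta> \<and> N < \<sigma> * snd z" if "\<eta> > 0" for N \<eta>
      using esc[OF that, of N] by blast
    from ray_in_closed_convex[OF cc(1,2) h(1) this \<sigma>(1) h_ge(1)] have "(a, h) \<in> K i0" .
    moreover have "\<exists>z\<in>K j0. \<bar>fst z - a\<bar> < \<eta> \<and> N < \<sigma> * snd z" if "\<eta> > 0" for N \<eta>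
      using esc[OF that, of N] by blast
    from ray_in_closed_convex[OF cc(3,4) h(2) this \<sigma>(1) h_ge(2)] have "(a, h) \<in> K j0" .
    ultimately show False
      using i0(3) by blast
  qed
  then obtain m where m: "m \<in> I" "\<And>y. (a, y) \<notin> K m"
    using i0 by blast
  have miss: "fst z \<noteq> a" if "z \<in> K m" for z
    using m(2)[of "snd z"] that by auto
  have Km: "closed (K m)" "convex (K m)"
    using K m by auto
  obtain \<sigma> :: real where \<sigma>: "\<sigma> \<in> {1, -1}"
      "\<And>N. \<exists>\<eta>>0. \<forall>z\<in>K m. \<bar>fst z - a\<bar> < \<eta> \<longrightarrow> N < \<sigma> * snd z"
    using escape_from_line[OF Km miss] by blast
  have esc: "\<exists>z\<in>K i \<inter> K m. \<bar>fst z - a\<bar> < \<eta> \<and> N < \<sigma> * snd z" if "i \<in> I" "\<eta> > 0" for i N \<eta>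
  proof -
    obtain \<eta>' where "\<eta>' > 0" "\<forall>z\<in>K m. \<bar>fst z - a\<bar> < \<eta>' \<longrightarrow> N < \<sigma> * snd z"
      using \<sigma>(2) by blast
    with near[OF that(1) m(1), of "min \<eta> \<eta>'"] that show ?thesis by auto
  qed
  \<comment> \<open>A convex set that misses the line lies on one side of it;
    \<open>\<kappa>\<close> records the side.\<close>
  have "\<not> (p \<in> K m \<and> q \<in> K m \<and> fst p - a \<le> 0 \<and> 0 \<le> fst q - a)" for p q
  proof
    assume "p \<in> K m \<and> q \<in> K m \<and> fst p - a \<le> 0 \<and> 0 \<le> fst q - a"
    then have "\<exists>v\<in>K m. fst v - a = 0"
      by (intro convex_zero[OF Km(2), of p q]) (auto simp: algebra_simps)
    with miss show False by auto
  qed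
  then have "(\<forall>z\<in>K m. 0 < fst z - a) \<or> (\<forall>z\<in>K m. fst z - a < 0)"
    by (meson linear not_le)
  then obtain \<kappa> :: real where \<kappa>: "\<kappa> \<in> {1, -1}" "\<And>z. z \<in> K m \<Longrightarrow> 0 < \<kappa> * (fst z - a)"
    by (metis insertI1 insertI2 mult_1 mult_minus1 neg_0_less_iff_less singletonI)
  have \<kappa>_abs: "\<kappa> * (fst z - a) = \<bar>fst z - a\<bar>" if "z \<in> K m" for z
    using \<kappa>(1) \<kappa>(2)[OF that] by auto
  obtain Z where Z: "\<And>i. i \<in> I \<Longrightarrow> Z i \<in> K i \<inter> K m \<and> \<bar>fst (Z i) - a\<bar> < \<epsilon>"
    using near[OF _ m(1) \<epsilon>] by metis
  \<comment> \<open>Half the least distance of the \<open>Z i\<close> from the line over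
    \<open>a\<close>, so that the line over \<open>c\<close> lies strictly between that line and
    every \<open>Z i\<close>.\<close>
  define \<mu> where "\<mu> = Min ((\<lambda>i. \<bar>fst (Z i) - a\<bar>) ` I) / 2"
  have "Min ((\<lambda>i. \<bar>fst (Z i) - a\<bar>) ` I) \<in> (\<lambda>i. \<bar>fst (Z i) - a\<bar>) ` I"
    using fin m by (intro Min_in) auto
  then have \<mu>: "\<mu> > 0"
    using Z miss by (fastforce simp: \<mu>_def)
  have \<mu>_less: "\<mu> < \<bar>fst (Z i) - a\<bar>" if "i \<in> I" for i
  proof -
    have "2 * \<mu> \<le> \<bar>fst (Z i) - a\<bar>"
      using fin that by (simp add: \<mu>_def)
    with \<mu> show ?thesis by linarith
  qed
  define c where "c = a + \<kappa> * \<mu>"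
  have high: "\<exists>y. (c, y) \<in> K i \<and> N \<le> \<sigma> * y" if i: "i \<in> I" for i N
  proof -
    define u1 where "u1 = \<bar>fst (Z i) - a\<bar>"
    \<comment> \<open>The segment from \<open>Z i\<close> to a point \<open>z\<close> closer to the
      line than \<open>\<mu>\<close> crosses the line over \<open>c\<close>, and \<open>z\<close>
      has weight at least \<open>t0\<close> there, however close it is. So \<open>B\<close> can be
      fixed before \<open>z\<close> and be large enough to outweigh both \<open>N\<close> and the
      height of \<open>Z i\<close>.\<close>
    define t0 where "t0 = (u1 - \<mu>) / u1"
    have u1: "\<mu> < u1" "0 < u1"
      using \<mu>_less[OF i] \<mu> by (auto simp: u1_def)
    then have t0: "0 < t0"
      by (simp add: t0_def)
    define B where "B = (\<bar>N\<bar> + \<bar>snd (Z i)\<bar>) / t0"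
    obtain z where z: "z \<in> K i" "z \<in> K m" "\<bar>fst z - a\<bar> < \<mu>" "B < \<sigma> * snd z"
      using esc[OF i \<mu>, of B] by blast
    define u where "u = \<bar>fst z - a\<bar>"
    define t where "t = (u1 - \<mu>) / (u1 - u)"
    have u: "0 \<le> u" "u < \<mu>"
      using z by (auto simp: u_def)
    have t: "0 \<le> t" "t \<le> 1" "t0 \<le> t"
      using u u1 by (auto simp: t_def t0_def divide_simps)
    have B0: "0 \<le> B" "t0 * B = \<bar>N\<bar> + \<bar>snd (Z i)\<bar>"
      using t0 by (auto simp: B_def)
    define v where "v = (1 - t) *\<^sub>R Z i + t *\<^sub>R z"
    have v: "v \<in> K i"
      using K[OF i] Z[OF i] z t by (auto simp: v_def convex_alt)
    have "(1 - t) * u1 + t * u = \<mu>"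
      using u u1 by (simp add: t_def divide_simps) (simp add: algebra_simps)
    moreover have "u1 = \<kappa> * (fst (Z i) - a)" "u = \<kappa> * (fst z - a)"
      using \<kappa>_abs Z i z by (auto simp: u1_def u_def)
    ultimately have "\<kappa> * (fst v - a) = \<mu>"
      by (simp add: v_def algebra_simps)
    then have "fst v = c"
      using \<kappa>(1) by (auto simp: c_def)
    moreover have "N \<le> \<sigma> * snd v"
    proof -
      have "t0 * B \<le> t * (\<sigma> * snd z)"
        using t t0 B0 z by (intro mult_mono) auto
      moreover have "- \<bar>snd (Z i)\<bar> \<le> (1 - t) * (\<sigma> * snd (Z i))"
      proof -
        have "\<bar>(1 - t) * (\<sigma> * snd (Z i))\<bar> \<le> \<bar>snd (Z i)\<bar>"
          using t \<sigma>(1) by (auto simp: abs_mult intro!: mult_left_le_one_le)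
        then show ?thesis by linarith
      qed
      ultimately show ?thesis
        using B0(2) by (simp add: v_def algebra_simps)
    qed
    ultimately show ?thesis
      using v by (metis prod.collapse)
  qed
  have "\<forall>i\<in>I. \<exists>y. (c, y) \<in> K i"
    using high by blast
  then obtain Y where Y: "\<And>i. i \<in> I \<Longrightarrow> (c, Y i) \<in> K i"
    by metis
  \<comment> \<open>Each \<open>K i\<close> contains on the line over \<open>c\<close> a point at
    most this high and one at least this high, measured along \<open>\<sigma>\<close>, so all
    contain the point at exactly this height.\<close>
  define N where "N = Max ((\<lambda>i. \<sigma> * Y i) ` I)"
  have "(c, \<sigma> * N) \<in> K i" if i: "i \<in> I" for i
  proof -
    obtain y where y: "(c, y) \<in> K i" "N \<le> \<sigma> * y"
      using high[OF i] by blast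
    have "\<sigma> * Y i \<le> N"
      unfolding N_def using fin i by (intro Max_ge) auto
    then have "\<exists>t. 0 \<le> t \<and> t \<le> 1 \<and> (1 - t) *\<^sub>R (c, Y i) + t *\<^sub>R (c, y) \<in> K i \<and>
        \<bar>\<sigma> * snd ((1 - t) *\<^sub>R (c, Y i) + t *\<^sub>R (c, y)) - N\<bar> \<le> 0"
      using y K[OF i] Y[OF i]
      by (intro convex_level[where f = "\<lambda>z. \<sigma> * snd z - N"]) (auto simp: algebra_simps)
    then obtain t where t: "(1 - t) *\<^sub>R (c, Y i) + t *\<^sub>R (c, y) \<in> K i"
        "\<sigma> * ((1 - t) * Y i + t * y) = N" by auto
    have "(1 - t) * Y i + t * y = \<sigma> * N"
      using t(2) \<sigma>(1) by auto
    with t(1) show ?thesis by (simp add: algebra_simps)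
  qed
  moreover have "\<bar>c - a\<bar> < \<epsilon>"
    using \<mu>_less[OF m(1)] Z[OF m(1)] \<mu> \<kappa>(1) by (auto simp: c_def)
  ultimately show ?thesis by force
qed

subsection \<open>Moving diagonally from a point of the rectangular hull\<close>

abbreviation signs :: "(real \<times> real) set" where
  "signs \<equiv> {1, -1} \<times> {1, -1}"

text \<open>The Minkowski sum of \<open>C\<close> and the closed quadrant of \<open>s\<close>, for \<open>s \<in> signs\<close>.\<close>

definition shadow :: "real \<times> real \<Rightarrow> (real \<times> real) set \<Rightarrow> (real \<times> real) set" where
  "shadow s C =
     {v. \<exists>k\<in>C. fst s * fst k \<le> fst s * fst v \<and> snd s * snd k \<le> snd s * snd v}"

text \<open>That is, \<open>a\<close> lies in the rectangular hull of the intersection of the convex sets \<open>K i\<close>.\<close>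

definition straddles :: "'b set \<Rightarrow> ('b \<Rightarrow> (real \<times> real) set) \<Rightarrow> real \<times> real \<Rightarrow> bool" where
  "straddles I K a \<longleftrightarrow>
     (\<forall>\<epsilon>>0. (\<exists>z\<in>\<Inter>(K ` I). \<bar>fst z - fst a\<bar> < \<epsilon>) \<and> (\<exists>z\<in>\<Inter>(K ` I). \<bar>snd z - snd a\<bar> < \<epsilon>))"

text \<open>Here \<open>\<delta>\<close> is the uniform distance from \<open>a\<close> to the
  intersection, attained in the diagonal direction \<open>s\<close>. Minimality is expressed by a
  single set \<open>K u\<close> whose shadow is missed. This is stronger than missing the shadow of
  the intersection, and it can be compared with the corresponding set at another point.\<close>

definition diagonal_entry ::
  "'b set \<Rightarrow> ('b \<Rightarrow> (real \<times> real) set) \<Rightarrow> real \<times> real \<Rightarrow> real \<times> real \<Rightarrow> real \<Rightarrow> bool" where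
  "diagonal_entry I K a s \<delta> \<longleftrightarrow> s \<in> signs \<and> 0 \<le> \<delta> \<and> a + \<delta> *\<^sub>R s \<in> \<Inter>(K ` I) \<and>
     (\<forall>\<tau>. 0 \<le> \<tau> \<and> \<tau> < \<delta> \<longrightarrow> (\<exists>u\<in>I. a + \<tau> *\<^sub>R s \<notin> shadow s (K u)))"

lemma dist_prod_le: "dist v w \<le> \<bar>fst v - fst w\<bar> + \<bar>snd v - snd w\<bar>" for v w :: "real \<times> real"
  by (simp add: dist_prod_def dist_real_def sqrt_sum_squares_le_sum_abs)

text \<open>Up to \<open>\<epsilon>\<close>, \<open>C\<close> has a point in each of the four
  quadrants at \<open>a\<close>. Joining the two lower ones and the two upper ones gives points
  \<open>p\<close> and \<open>q\<close> almost below and above \<open>a\<close>, and the segment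
  between these passes close to \<open>a\<close>.\<close>

lemma mem_closed_if_all_shadows:
  assumes C: "closed C" "convex C"
    and sh: "\<And>s \<epsilon>. s \<in> signs \<Longrightarrow> \<epsilon> > 0 \<Longrightarrow> a + \<epsilon> *\<^sub>R s \<in> shadow s C"
  shows "a \<in> C"
proof (rule ccontr)
  assume "a \<notin> C"
  then obtain e where e: "e > 0" "ball a e \<subseteq> - C"
    using C by (metis open_contains_ball open_Compl ComplI)
  define \<epsilon> where "\<epsilon> = e / 3"
  have \<epsilon>: "\<epsilon> > 0" using e by (simp add: \<epsilon>_def)
  have level: "\<exists>t. 0 \<le> t \<and> t \<le> 1 \<and> (1 - t) *\<^sub>R p + t *\<^sub>R q \<in> C \<and> \<bar>(1 - t) * fst p + t * fst q - fst a\<bar> \<le> \<epsilon>"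
    if "p \<in> C" "q \<in> C" "fst p \<le> fst a + \<epsilon>" "fst a - \<epsilon> \<le> fst q" for p q
    using convex_level[OF C(2) that(1,2), of \<epsilon> "\<lambda>v. fst v - fst a"] \<epsilon> that
    by (auto simp: algebra_simps)
  obtain k1 where k1: "k1 \<in> C" "fst k1 \<le> fst a + \<epsilon>" "snd k1 \<le> snd a + \<epsilon>"
    using sh[of "(1, 1)" \<epsilon>] \<epsilon> by (auto simp: shadow_def)
  obtain k2 where k2: "k2 \<in> C" "fst a - \<epsilon> \<le> fst k2" "snd k2 \<le> snd a + \<epsilon>"
    using sh[of "(-1, 1)" \<epsilon>] \<epsilon> by (auto simp: shadow_def)
  obtain k3 where k3: "k3 \<in> C" "fst k3 \<le> fst a + \<epsilon>" "snd a - \<epsilon> \<le> snd k3"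
    using sh[of "(1, -1)" \<epsilon>] \<epsilon> by (auto simp: shadow_def)
  obtain k4 where k4: "k4 \<in> C" "fst a - \<epsilon> \<le> fst k4" "snd a - \<epsilon> \<le> snd k4"
    using sh[of "(-1, -1)" \<epsilon>] \<epsilon> by (auto simp: shadow_def)
  obtain p where p: "p \<in> C" "\<bar>fst p - fst a\<bar> \<le> \<epsilon>" "snd p \<le> snd a + \<epsilon>"
  proof -
    obtain t where "0 \<le> t" "t \<le> 1" "(1 - t) *\<^sub>R k1 + t *\<^sub>R k2 \<in> C" "\<bar>(1 - t) * fst k1 + t * fst k2 - fst a\<bar> \<le> \<epsilon>"
      using level k1 k2 by blast
    then show thesis
      using k1 k2 by (intro that[of "(1 - t) *\<^sub>R k1 + t *\<^sub>R k2"]) (auto intro: convex_comb_le)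
  qed
  obtain q where q: "q \<in> C" "\<bar>fst q - fst a\<bar> \<le> \<epsilon>" "snd a - \<epsilon> \<le> snd q"
  proof -
    obtain t where "0 \<le> t" "t \<le> 1" "(1 - t) *\<^sub>R k3 + t *\<^sub>R k4 \<in> C" "\<bar>(1 - t) * fst k3 + t * fst k4 - fst a\<bar> \<le> \<epsilon>"
      using level k3 k4 by blast
    then show thesis
      using k3 k4 by (intro that[of "(1 - t) *\<^sub>R k3 + t *\<^sub>R k4"]) (auto intro: convex_comb_ge)
  qed
  obtain t where t: "0 \<le> t" "t \<le> 1" "(1 - t) *\<^sub>R p + t *\<^sub>R q \<in> C" "\<bar>(1 - t) * snd p + t * snd q - snd a\<bar> \<le> \<epsilon>"
    using convex_level[OF C(2) p(1) q(1), of \<epsilon> "\<lambda>v. snd v - snd a"] \<epsilon> p q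
    by (auto simp: algebra_simps)
  have "(1 - t) * fst p + t * fst q \<le> fst a + \<epsilon>" "fst a - \<epsilon> \<le> (1 - t) * fst p + t * fst q"
    using t p q by (auto intro!: convex_comb_le convex_comb_ge)
  then have "dist ((1 - t) *\<^sub>R p + t *\<^sub>R q) a \<le> \<epsilon> + \<epsilon>"
    using t(4) by (intro order_trans[OF dist_prod_le] add_mono) auto
  then have "(1 - t) *\<^sub>R p + t *\<^sub>R q \<in> ball a e"
    using \<epsilon> by (simp add: \<epsilon>_def dist_commute)
  with e t show False by blast
qed

text \<open>The normalised case \<open>a = 0\<close>, \<open>s = (1, 1)\<close>. The candidate
  \<open>\<delta>\<close> is the infimum of the \<open>\<tau>\<close> for which
  \<open>(\<tau>, \<tau>)\<close> lies in all shadows; the bound \<open>\<epsilon>0\<close> makes it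
  positive.\<close>

lemma diagonal_entry_origin:
  fixes K :: "'b \<Rightarrow> (real \<times> real) set"
  assumes K: "\<And>i. i \<in> I \<Longrightarrow> closed (K i) \<and> convex (K i)"
    and str: "straddles I K 0"
    and \<epsilon>0: "\<epsilon>0 > 0" "\<not> (\<forall>u\<in>I. \<exists>k\<in>K u. fst k \<le> \<epsilon>0 \<and> snd k \<le> \<epsilon>0)"
  shows "\<exists>\<delta>>0. (\<forall>u\<in>I. (\<delta>, \<delta>) \<in> K u) \<and> (\<forall>\<tau><\<delta>. \<exists>u\<in>I. \<forall>k\<in>K u. \<not> (fst k \<le> \<tau> \<and> snd k \<le> \<tau>))"
proof -
  define T where "T = {\<tau>. \<forall>u\<in>I. \<exists>k\<in>K u. fst k \<le> \<tau> \<and> snd k \<le> \<tau>}"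
  define S where "S = \<Inter>(K ` I)"
  have convS: "convex S"
    unfolding S_def using K by (intro convex_INT) auto
  have T_mono: "\<tau>' \<in> T" if "\<tau> \<in> T" "\<tau> \<le> \<tau>'" for \<tau> \<tau>'
    using that unfolding T_def mem_Collect_eq by (meson order_trans)
  have T_S: "\<tau> \<in> T" if "z \<in> S" "fst z \<le> \<tau>" "snd z \<le> \<tau>" for z \<tau>
    using that unfolding T_def S_def by blast
  obtain z0 where "z0 \<in> S"
    using str \<epsilon>0(1) unfolding straddles_def S_def by blast
  then have T_ne: "T \<noteq> {}"
    using T_S[of z0 "max (fst z0) (snd z0)"] by auto
  have "\<epsilon>0 \<notin> T"
    using \<epsilon>0(2) unfolding T_def by blast
  then have T_lb: "\<epsilon>0 < \<tau>" if "\<tau> \<in> T" for \<tau>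
    using T_mono[OF that, of \<epsilon>0] by linarith
  have bdd: "bdd_below T"
    using T_lb by (intro bdd_belowI[of _ \<epsilon>0]) (simp add: less_imp_le)
  define \<delta> where "\<delta> = Inf T"
  have \<delta>_le: "\<delta> \<le> \<tau>" if "\<tau> \<in> T" for \<tau>
    unfolding \<delta>_def using that bdd by (rule cInf_lower)
  have \<delta>_pos: "\<delta> > 0"
    using cInf_greatest[OF T_ne, of \<epsilon>0] T_lb \<epsilon>0(1) unfolding \<delta>_def by (meson less_imp_le less_le_trans)
  have \<delta>_near: "\<exists>\<tau>\<in>T. \<tau> < \<delta> + \<epsilon>" if "\<epsilon> > 0" for \<epsilon>
    using cInf_lessD[OF T_ne, of "\<delta> + \<epsilon>"] that by (auto simp: \<delta>_def)
  \<comment> \<open>Since \<open>\<delta>\<close> is positive, straddling gives common points with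
    one coordinate below \<open>\<delta>\<close>. Their other coordinate is at least
    \<open>\<delta>\<close>, so they lie on opposite sides of the diagonal, and the segment between
    them meets it in a common point \<open>c\<close> at or beyond
    \<open>(\<delta>, \<delta>)\<close>.\<close>
  obtain z where z: "z \<in> S" "fst z < \<delta>"
    using str[unfolded straddles_def] \<delta>_pos abs_less_iff unfolding S_def by (metis diff_zero fst_zero)
  obtain z' where z': "z' \<in> S" "snd z' < \<delta>"
    using str[unfolded straddles_def] \<delta>_pos abs_less_iff unfolding S_def by (metis diff_zero snd_zero)
  have z_order: "fst z < snd z" "snd z' < fst z'"
    using \<delta>_le[OF T_S[of z "max (fst z) (snd z)"]] \<delta>_le[OF T_S[of z' "max (fst z') (snd z')"]] z z'
    by auto
  obtain c where c: "c \<in> S" "fst c = snd c"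
    using convex_zero[OF convS z(1) z'(1), of "\<lambda>v. fst v - snd v"] z_order
    by (auto simp: algebra_simps)
  have c_ge: "\<delta> \<le> fst c"
    using \<delta>_le[OF T_S[of c "fst c"]] c by auto
  have "(\<delta>, \<delta>) \<in> K u" if u: "u \<in> I" for u
  proof (rule ccontr)
    assume notin: "(\<delta>, \<delta>) \<notin> K u"
    then obtain e where e: "e > 0" "ball (\<delta>, \<delta>) e \<subseteq> - K u"
      using K[OF u] by (metis open_contains_ball open_Compl ComplI)
    have in_K: "z \<in> K u" "z' \<in> K u" "c \<in> K u"
      using z z' c u by (auto simp: S_def)
    obtain k where k: "k \<in> K u" "fst k \<le> \<delta> + e / 3" "snd k \<le> \<delta> + e / 3"
      using \<delta>_near[of "e / 3"] e u unfolding T_def by fastforce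
    \<comment> \<open>Joining \<open>k\<close> to whichever of \<open>z\<close>, \<open>z'\<close>
      lies across the diagonal gives a diagonal point of \<open>K u\<close> not far beyond
      \<open>(\<delta>, \<delta>)\<close>: the coordinate that is below \<open>\<delta>\<close> at
      \<open>z\<close> or \<open>z'\<close> controls it.\<close>
    obtain w where w: "w \<in> K u" "fst w = snd w" "fst w \<le> \<delta> + e / 3"
    proof (cases "fst k \<le> snd k")
      case True
      then obtain t where "0 \<le> t" "t \<le> 1" "(1 - t) *\<^sub>R k + t *\<^sub>R z' \<in> K u"
          "(1 - t) * fst k + t * fst z' = (1 - t) * snd k + t * snd z'"
        using convex_level[of "K u" k z' 0 "\<lambda>v. fst v - snd v"] K[OF u] k in_K z_order
        by (auto simp: algebra_simps)
      moreover from this have "(1 - t) * snd k + t * snd z' \<le> \<delta> + e / 3"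
        using k z' e by (intro convex_comb_le) auto
      ultimately show thesis
        by (intro that[of "(1 - t) *\<^sub>R k + t *\<^sub>R z'"]) auto
    next
      case False
      then obtain t where "0 \<le> t" "t \<le> 1" "(1 - t) *\<^sub>R z + t *\<^sub>R k \<in> K u"
          "(1 - t) * fst z + t * fst k = (1 - t) * snd z + t * snd k"
        using convex_level[of "K u" z k 0 "\<lambda>v. fst v - snd v"] K[OF u] k in_K z_order
        by (auto simp: algebra_simps)
      moreover from this have "(1 - t) * fst z + t * fst k \<le> \<delta> + e / 3"
        using k z e by (intro convex_comb_le) auto
      ultimately show thesis
        by (intro that[of "(1 - t) *\<^sub>R z + t *\<^sub>R k"]) auto
    qed
    \<comment> \<open>If \<open>w\<close> came before \<open>(\<delta>, \<delta>)\<close>, the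
      segment from \<open>w\<close> to \<open>c\<close> would contain it.\<close>
    have "\<not> fst w < \<delta>"
    proof
      assume "fst w < \<delta>"
      then obtain t where t: "0 \<le> t" "t \<le> 1" "(1 - t) *\<^sub>R w + t *\<^sub>R c \<in> K u"
          "(1 - t) * fst w + t * fst c = \<delta>"
        using convex_level[of "K u" w c 0 "\<lambda>v. fst v - \<delta>"] K[OF u] w in_K c_ge
        by (auto simp: algebra_simps)
      then have "(1 - t) *\<^sub>R w + t *\<^sub>R c = (\<delta>, \<delta>)"
        using w c by (simp add: prod_eq_iff)
      with t notin show False by simp
    qed
    then have "dist w (\<delta>, \<delta>) \<le> e / 3 + e / 3"
      using w by (intro order_trans[OF dist_prod_le] add_mono) auto
    then have "w \<in> ball (\<delta>, \<delta>) e"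
      using e by (simp add: dist_commute)
    with e w show False by blast
  qed
  moreover have "\<exists>u\<in>I. \<forall>k\<in>K u. \<not> (fst k \<le> \<tau> \<and> snd k \<le> \<tau>)" if "\<tau> < \<delta>" for \<tau>
    using \<delta>_le[of \<tau>] that unfolding T_def by force
  ultimately show ?thesis
    using \<delta>_pos by blast
qed

text \<open>A point outside some \<open>K u\<close> misses one of its shadows even after a small
  step, and this selects the signs \<open>s\<close>. A reflection and a translation reduce to the
  normalised case.\<close>

lemma diagonal_entry_exists:
  assumes K: "\<And>i. i \<in> I \<Longrightarrow> closed (K i) \<and> convex (K i)"
    and str: "straddles I K a"
  shows "\<exists>s \<delta>. diagonal_entry I K a s \<delta>"
proof (cases "a \<in> \<Inter>(K ` I)")
  case True
  then show ?thesis
    by (intro exI[of _ "(1, 1)"] exI[of _ 0]) (auto simp: diagonal_entry_def simp flip: zero_prod_def)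
next
  case False
  then obtain u where u: "u \<in> I" "a \<notin> K u"
    by blast
  then obtain s \<epsilon> where s: "s \<in> signs" and \<epsilon>: "\<epsilon> > 0" "a + \<epsilon> *\<^sub>R s \<notin> shadow s (K u)"
    using mem_closed_if_all_shadows[of "K u" a] K[of u] by blast
  have ss: "fst s * fst s = 1" "snd s * snd s = 1" "\<bar>fst s\<bar> = 1" "\<bar>snd s\<bar> = 1"
    using s by auto
  \<comment> \<open>Coordinates with origin \<open>a\<close> and axes directed by \<open>s\<close>;
    \<open>g\<close> is the inverse of \<open>h\<close> because signs are their own
    reciprocals.\<close>
  define h :: "real \<times> real \<Rightarrow> real \<times> real" where "h v = a + (fst s * fst v, snd s * snd v)" for v
  define g :: "real \<times> real \<Rightarrow> real \<times> real" where "g v = (fst s * (fst v - fst a), snd s * (snd v - snd a))" for v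
  have hg: "h (g v) = v" for v
    using ss by (simp add: h_def g_def prod_eq_iff flip: mult.assoc)
  have h_scale: "h (\<tau>, \<tau>) = a + \<tau> *\<^sub>R s" for \<tau>
    by (simp add: h_def prod_eq_iff)
  have shadow_h: "a + \<tau> *\<^sub>R s \<in> shadow s C \<longleftrightarrow> (\<exists>k\<in>h -` C. fst k \<le> \<tau> \<and> snd k \<le> \<tau>)" for \<tau> C
  proof
    assume "a + \<tau> *\<^sub>R s \<in> shadow s C"
    then obtain k where k: "k \<in> C" "fst s * fst k \<le> fst s * (fst a + \<tau> * fst s)"
        "snd s * snd k \<le> snd s * (snd a + \<tau> * snd s)"
      by (auto simp: shadow_def)
    then have "fst (g k) \<le> \<tau>" "snd (g k) \<le> \<tau>"
      using s by (auto simp: g_def)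
    moreover have "g k \<in> h -` C"
      using k by (simp add: hg)
    ultimately show "\<exists>k\<in>h -` C. fst k \<le> \<tau> \<and> snd k \<le> \<tau>"
      by blast
  next
    assume "\<exists>k\<in>h -` C. fst k \<le> \<tau> \<and> snd k \<le> \<tau>"
    then obtain k where "k \<in> h -` C" and k_le: "fst k \<le> \<tau>" "snd k \<le> \<tau>" by blast
    then have k: "h k \<in> C" by simp
    have "fst s * fst (h k) \<le> fst s * fst (a + \<tau> *\<^sub>R s)" "snd s * snd (h k) \<le> snd s * snd (a + \<tau> *\<^sub>R s)"
      using s k_le by (auto simp: h_def)
    with k show "a + \<tau> *\<^sub>R s \<in> shadow s C"
      unfolding shadow_def by blast
  qed
  have cc: "closed (h -` K i) \<and> convex (h -` K i)" if "i \<in> I" for i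
  proof
    show "closed (h -` K i)"
      using K[OF that] unfolding h_def by (intro closed_vimage continuous_intros) auto
    have "h ((1 - t) *\<^sub>R x + t *\<^sub>R y) = (1 - t) *\<^sub>R h x + t *\<^sub>R h y" for t x y
      by (simp add: h_def prod_eq_iff algebra_simps)
    then show "convex (h -` K i)"
      using K[OF that] by (simp add: convex_alt)
  qed
  have str': "straddles I (\<lambda>i. h -` K i) 0"
    unfolding straddles_def
  proof (intro allI impI conjI)
    fix \<epsilon> :: real assume "\<epsilon> > 0"
    then obtain z z' where "z \<in> \<Inter>(K ` I)" "\<bar>fst z - fst a\<bar> < \<epsilon>" "z' \<in> \<Inter>(K ` I)" "\<bar>snd z' - snd a\<bar> < \<epsilon>"
      using str unfolding straddles_def by blast
    then have "g z \<in> (\<Inter>i\<in>I. h -` K i)" "\<bar>fst (g z) - fst 0\<bar> < \<epsilon>"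
        "g z' \<in> (\<Inter>i\<in>I. h -` K i)" "\<bar>snd (g z') - snd 0\<bar> < \<epsilon>"
      using ss by (auto simp: hg) (auto simp: g_def abs_mult)
    then show "\<exists>z\<in>\<Inter>i\<in>I. h -` K i. \<bar>fst z - fst 0\<bar> < \<epsilon>" "\<exists>z\<in>\<Inter>i\<in>I. h -` K i. \<bar>snd z - snd 0\<bar> < \<epsilon>"
      by blast+
  qed
  have "\<not> (\<forall>u\<in>I. \<exists>k\<in>h -` K u. fst k \<le> \<epsilon> \<and> snd k \<le> \<epsilon>)"
    using u \<epsilon>(2) unfolding shadow_h by blast
  from diagonal_entry_origin[OF cc str' \<epsilon>(1) this]
  obtain \<delta> where \<delta>: "\<delta> > 0" "\<And>u. u \<in> I \<Longrightarrow> h (\<delta>, \<delta>) \<in> K u"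
      "\<And>\<tau>. \<tau> < \<delta> \<Longrightarrow> \<exists>u\<in>I. \<forall>k\<in>h -` K u. \<not> (fst k \<le> \<tau> \<and> snd k \<le> \<tau>)"
    by (metis vimage_eq)
  then have "diagonal_entry I K a s \<delta>"
    using s unfolding diagonal_entry_def shadow_h h_scale by (auto simp: less_imp_le)
  then show ?thesis by blast
qed

section \<open>Comparison of diagonal entries at two points\<close>

text \<open>Every \<open>K u\<close> has a point within \<open>r\<close> of the entry point at
  \<open>b\<close>. After a step \<open>\<delta>' + r + D\<close> along \<open>s\<close>, the point
  starting at \<open>a\<close> dominates all of these, whatever the signs \<open>t\<close> are, so
  it lies in all shadows.\<close>

lemma diagonal_entry_le:
  assumes x: "diagonal_entry I K a s \<delta>" and y: "diagonal_entry I K' b t \<delta>'"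
    and close: "\<And>u k. u \<in> I \<Longrightarrow> k \<in> K' u \<Longrightarrow> \<exists>k'\<in>K u. \<bar>fst k - fst k'\<bar> \<le> r \<and> \<bar>snd k - snd k'\<bar> \<le> r"
    and D: "\<bar>fst a - fst b\<bar> \<le> D" "\<bar>snd a - snd b\<bar> \<le> D" and r: "0 \<le> r"
  shows "\<delta> \<le> \<delta>' + r + D"
proof (rule ccontr)
  assume "\<not> ?thesis"
  moreover have st: "s \<in> signs" "t \<in> signs" "0 \<le> \<delta>'"
    using x y by (auto simp: diagonal_entry_def)
  ultimately obtain u where u: "u \<in> I" "a + (\<delta>' + r + D) *\<^sub>R s \<notin> shadow s (K u)"
    using x D r unfolding diagonal_entry_def by (smt (verit))
  have "b + \<delta>' *\<^sub>R t \<in> K' u"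
    using y u by (simp add: diagonal_entry_def)
  then obtain k where k: "k \<in> K u" "\<bar>fst b + \<delta>' * fst t - fst k\<bar> \<le> r" "\<bar>snd b + \<delta>' * snd t - snd k\<bar> \<le> r"
    using close[OF u(1)] by fastforce
  then have "fst s * fst k \<le> fst s * fst (a + (\<delta>' + r + D) *\<^sub>R s)" "snd s * snd k \<le> snd s * snd (a + (\<delta>' + r + D) *\<^sub>R s)"
    using st D by (auto simp: abs_le_iff)
  with k(1) u(2) show False
    by (auto simp: shadow_def)
qed

text \<open>The entry point at \<open>b\<close> lies backwards along \<open>s\<close>, so a step of
  only \<open>r + D - \<delta>'\<close> from \<open>a\<close> already reaches all shadows.\<close>

lemma diagonal_entry_opposite:
  assumes x: "diagonal_entry I K a s \<delta>" and y: "diagonal_entry I K' b (- s) \<delta>'"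
    and close: "\<And>u k. u \<in> I \<Longrightarrow> k \<in> K' u \<Longrightarrow> \<exists>k'\<in>K u. \<bar>fst k - fst k'\<bar> \<le> r \<and> \<bar>snd k - snd k'\<bar> \<le> r"
    and D: "\<bar>fst a - fst b\<bar> \<le> D" "\<bar>snd a - snd b\<bar> \<le> D"
    and pos: "\<delta> > 0"
  shows "\<delta> + \<delta>' \<le> r + D"
proof (rule ccontr)
  assume neg: "\<not> ?thesis"
  have s: "s \<in> signs"
    using x by (auto simp: diagonal_entry_def)
  \<comment> \<open>Truncated at 0 because minimality of \<open>\<delta>\<close> speaks only of
    nonnegative steps.\<close>
  define \<tau> where "\<tau> = max 0 (r + D - \<delta>')"
  obtain u where u: "u \<in> I" "a + \<tau> *\<^sub>R s \<notin> shadow s (K u)"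
    using x neg pos unfolding diagonal_entry_def \<tau>_def by (smt (verit))
  have "b + \<delta>' *\<^sub>R (- s) \<in> K' u"
    using y u by (simp add: diagonal_entry_def)
  then obtain k where k: "k \<in> K u" "\<bar>fst b - \<delta>' * fst s - fst k\<bar> \<le> r" "\<bar>snd b - \<delta>' * snd s - snd k\<bar> \<le> r"
    using close[OF u(1)] by fastforce
  have "r + D - \<delta>' \<le> \<tau>"
    by (simp add: \<tau>_def)
  then have "fst s * fst k \<le> fst s * fst (a + \<tau> *\<^sub>R s)" "snd s * snd k \<le> snd s * snd (a + \<tau> *\<^sub>R s)"
    using s D k by (auto simp: abs_le_iff)
  with k(1) u(2) show False
    by (auto simp: shadow_def)
qed

text \<open>The functionals \<open>f\<close> and \<open>g\<close> stand for signed coordinates: the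
  two diagonals are opposite in \<open>f\<close> and agree in \<open>g\<close>. At height about
  \<open>g a\<close> the set \<open>K u\<close> obstructs on the far side of \<open>a\<close> in
  \<open>f\<close>, and \<open>K' u'\<close> obstructs on the other side of \<open>b\<close>. Convex
  combinations with the same weights in both sets have \<open>f\<close>-values at most
  \<open>r\<close> apart, which bounds the gap between the obstructions.\<close>

lemma opposite_shadows:
  fixes f g :: "real \<times> real \<Rightarrow> real"
  assumes lin: "linear f" "linear g"
    and conv: "\<And>u. u \<in> I \<Longrightarrow> convex (K u) \<and> convex (K' u)"
    and close: "\<And>u k. u \<in> I \<Longrightarrow> k \<in> K' u \<Longrightarrow> \<exists>k'\<in>K u. \<bar>f k - f k'\<bar> \<le> r \<and> \<bar>g k - g k'\<bar> \<le> r"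
    and close': "\<And>u k. u \<in> I \<Longrightarrow> k \<in> K u \<Longrightarrow> \<exists>k'\<in>K' u. \<bar>f k - f k'\<bar> \<le> r \<and> \<bar>g k - g k'\<bar> \<le> r"
    and D: "\<bar>f a - f b\<bar> \<le> D" "\<bar>g a - g b\<bar> \<le> D"
    and str: "\<And>\<epsilon>. \<epsilon> > 0 \<Longrightarrow> \<exists>z\<in>\<Inter>(K ` I). g z < g a + \<epsilon>" "\<And>\<epsilon>. \<epsilon> > 0 \<Longrightarrow> \<exists>z\<in>\<Inter>(K' ` I). g z < g b + \<epsilon>"
    and u: "u \<in> I" "\<And>k. k \<in> K u \<Longrightarrow> g k \<le> g a + \<tau> \<Longrightarrow> f a + \<tau> < f k"
    and u': "u' \<in> I" "\<And>k. k \<in> K' u' \<Longrightarrow> g k \<le> g b + \<tau>' \<Longrightarrow> f k < f b - \<tau>'"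
    and \<tau>: "0 < \<tau>" "0 < \<tau>'"
  shows "\<tau> + \<tau>' \<le> r + D"
proof (rule ccontr)
  assume neg: "\<not> ?thesis"
  \<comment> \<open>These weights divide \<open>\<tau> + \<tau>'\<close> into \<open>\<tau>\<close>
    and \<open>\<tau>'\<close>. Each combination contains one transferred point, which may exceed
    the height by \<open>r + D\<close>; its share of this excess, plus \<open>\<epsilon>\<close>,
    still fits below \<open>\<tau>\<close> or \<open>\<tau>'\<close>.\<close>
  define \<theta> where "\<theta> = \<tau> / (\<tau> + \<tau>')"
  have \<theta>: "0 < \<theta>" "\<theta> < 1" "\<theta> * (\<tau> + \<tau>') = \<tau>" "(1 - \<theta>) * (\<tau> + \<tau>') = \<tau>'"
    using \<tau> by (auto simp: \<theta>_def field_simps)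
  define \<epsilon> where "\<epsilon> = (\<tau> + \<tau>' - (r + D)) * min \<theta> (1 - \<theta>)"
  have \<epsilon>: "0 < \<epsilon>"
    using neg \<theta> by (simp add: \<epsilon>_def)
  have \<epsilon>_le: "\<epsilon> \<le> (\<tau> + \<tau>' - (r + D)) * \<theta>" "\<epsilon> \<le> (\<tau> + \<tau>' - (r + D)) * (1 - \<theta>)"
    unfolding \<epsilon>_def using neg by (auto intro!: mult_left_mono)
  obtain z where z: "\<And>v. v \<in> I \<Longrightarrow> z \<in> K v" "g z < g a + \<epsilon>"
    using str(1)[OF \<epsilon>] by auto
  obtain w where w: "\<And>v. v \<in> I \<Longrightarrow> w \<in> K' v" "g w < g b + \<epsilon>"
    using str(2)[OF \<epsilon>] by auto
  have comb: "h (\<theta> *\<^sub>R p + (1 - \<theta>) *\<^sub>R q) = \<theta> * h p + (1 - \<theta>) * h q" if "linear h" for h :: "real \<times> real \<Rightarrow> real" and p q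
    using that by (simp add: linear_add linear_cmul)
  have mem: "\<theta> *\<^sub>R p + (1 - \<theta>) *\<^sub>R q \<in> C" if "convex C" "p \<in> C" "q \<in> C" for C and p q :: "real \<times> real"
    using that \<theta> by (intro convexD) auto
  \<comment> \<open>The low common points are transferred crosswise, \<open>w\<close> into
    \<open>K u\<close> and \<open>z\<close> into \<open>K' u'\<close>, so that each obstructing set
    contains a version of both.\<close>
  obtain w' where w': "w' \<in> K u" "\<bar>f w - f w'\<bar> \<le> r" "\<bar>g w - g w'\<bar> \<le> r"
    using close w u by blast
  obtain z' where z': "z' \<in> K' u'" "\<bar>f z - f z'\<bar> \<le> r" "\<bar>g z - g z'\<bar> \<le> r"
    using close' z u' by blast
  have "f a + \<tau> < \<theta> * f w' + (1 - \<theta>) * f z"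
  proof -
    have "\<theta> * g w' \<le> \<theta> * (g a + D + r + \<epsilon>)" "(1 - \<theta>) * g z \<le> (1 - \<theta>) * (g a + \<epsilon>)"
      using \<theta> w' w z D by (auto intro!: mult_left_mono)
    then have "\<theta> * g w' + (1 - \<theta>) * g z \<le> g a + \<tau>"
      using \<epsilon>_le \<theta> by (simp add: algebra_simps)
    then show ?thesis
      using u(2)[of "\<theta> *\<^sub>R w' + (1 - \<theta>) *\<^sub>R z"] mem[of "K u" w' z] conv w' z u by (simp add: comb lin)
  qed
  moreover have "\<theta> * f w + (1 - \<theta>) * f z' < f b - \<tau>'"
  proof -
    have "\<theta> * g w \<le> \<theta> * (g b + \<epsilon>)" "(1 - \<theta>) * g z' \<le> (1 - \<theta>) * (g b + D + r + \<epsilon>)"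
      using \<theta> z' w z D by (auto intro!: mult_left_mono)
    then have "\<theta> * g w + (1 - \<theta>) * g z' \<le> g b + \<tau>'"
      using \<epsilon>_le \<theta> by (simp add: algebra_simps)
    then show ?thesis
      using u'(2)[of "\<theta> *\<^sub>R w + (1 - \<theta>) *\<^sub>R z'"] mem[of "K' u'" w z'] conv z' w u' by (simp add: comb lin)
  qed
  moreover have "\<theta> * f w' \<le> \<theta> * (f w + r)" "(1 - \<theta>) * (f z - r) \<le> (1 - \<theta>) * f z'"
    using \<theta> w' z' by (auto intro!: mult_left_mono)
  ultimately show False
    using D neg by (simp add: algebra_simps)
qed

text \<open>The coordinate with differing signs plays the role of \<open>f\<close>, the other that
  of \<open>g\<close>. Obstructing sets exist for all steps strictly below \<open>\<delta>\<close>
  and \<open>\<delta>'\<close>, and the bound passes to the limit.\<close>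

lemma diagonal_entry_adjacent:
  assumes x: "diagonal_entry I K a s \<delta>" and y: "diagonal_entry I K' b t \<delta>'"
    and str: "straddles I K a" "straddles I K' b"
    and conv: "\<And>u. u \<in> I \<Longrightarrow> convex (K u) \<and> convex (K' u)"
    and close: "\<And>u k. u \<in> I \<Longrightarrow> k \<in> K' u \<Longrightarrow> \<exists>k'\<in>K u. \<bar>fst k - fst k'\<bar> \<le> r \<and> \<bar>snd k - snd k'\<bar> \<le> r"
    and close': "\<And>u k. u \<in> I \<Longrightarrow> k \<in> K u \<Longrightarrow> \<exists>k'\<in>K' u. \<bar>fst k - fst k'\<bar> \<le> r \<and> \<bar>snd k - snd k'\<bar> \<le> r"
    and D: "\<bar>fst a - fst b\<bar> \<le> D" "\<bar>snd a - snd b\<bar> \<le> D"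
    and pos: "0 < \<delta>" "0 < \<delta>'"
    and st: "fst s \<noteq> fst t \<and> snd s = snd t \<or> fst s = fst t \<and> snd s \<noteq> snd t"
  shows "\<delta> + \<delta>' \<le> r + D"
proof -
  have signs: "s \<in> signs" "t \<in> signs"
    using x y by (auto simp: diagonal_entry_def)
  have "\<tau> + \<tau>' \<le> r + D" if \<tau>: "0 < \<tau>" "\<tau> < \<delta>" "0 < \<tau>'" "\<tau>' < \<delta>'" for \<tau> \<tau>'
  proof -
    obtain u where u: "u \<in> I" "a + \<tau> *\<^sub>R s \<notin> shadow s (K u)"
      using x \<tau> less_imp_le unfolding diagonal_entry_def by blast
    obtain u' where u': "u' \<in> I" "b + \<tau>' *\<^sub>R t \<notin> shadow t (K' u')"
      using y \<tau> less_imp_le unfolding diagonal_entry_def by blast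
    have str1: "\<exists>z\<in>\<Inter>(K ` I). fst s * fst z < fst s * fst a + \<epsilon>" "\<exists>z\<in>\<Inter>(K ` I). snd s * snd z < snd s * snd a + \<epsilon>" if "\<epsilon> > 0" for \<epsilon>
    proof -
      obtain z z' where "z \<in> \<Inter>(K ` I)" "\<bar>fst z - fst a\<bar> < \<epsilon>" "z' \<in> \<Inter>(K ` I)" "\<bar>snd z' - snd a\<bar> < \<epsilon>"
        using str(1) \<open>\<epsilon> > 0\<close> unfolding straddles_def by blast
      moreover have "fst s * fst z < fst s * fst a + \<epsilon>" "snd s * snd z' < snd s * snd a + \<epsilon>"
        using calculation(2,4) signs by auto
      ultimately show "\<exists>z\<in>\<Inter>(K ` I). fst s * fst z < fst s * fst a + \<epsilon>" "\<exists>z\<in>\<Inter>(K ` I). snd s * snd z < snd s * snd a + \<epsilon>"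
        by blast+
    qed
    have str2: "\<exists>z\<in>\<Inter>(K' ` I). fst s * fst z < fst s * fst b + \<epsilon>" "\<exists>z\<in>\<Inter>(K' ` I). snd s * snd z < snd s * snd b + \<epsilon>" if "\<epsilon> > 0" for \<epsilon>
    proof -
      obtain z z' where "z \<in> \<Inter>(K' ` I)" "\<bar>fst z - fst b\<bar> < \<epsilon>" "z' \<in> \<Inter>(K' ` I)" "\<bar>snd z' - snd b\<bar> < \<epsilon>"
        using str(2) \<open>\<epsilon> > 0\<close> unfolding straddles_def by blast
      moreover have "fst s * fst z < fst s * fst b + \<epsilon>" "snd s * snd z' < snd s * snd b + \<epsilon>"
        using calculation(2,4) signs by auto
      ultimately show "\<exists>z\<in>\<Inter>(K' ` I). fst s * fst z < fst s * fst b + \<epsilon>" "\<exists>z\<in>\<Inter>(K' ` I). snd s * snd z < snd s * snd b + \<epsilon>"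
        by blast+
    qed
    have abs: "\<bar>fst s * x - fst s * y\<bar> = \<bar>x - y\<bar>" "\<bar>snd s * x - snd s * y\<bar> = \<bar>x - y\<bar>" for x y
      using signs by auto
    have sq: "fst s * (\<tau> * fst s) = \<tau>" "snd s * (\<tau> * snd s) = \<tau>" "fst t * (\<tau>' * fst t) = \<tau>'" "snd t * (\<tau>' * snd t) = \<tau>'"
      using signs by auto
    have lin: "linear (\<lambda>p. fst s * fst p)" "linear (\<lambda>p. snd s * snd p)"
      by (auto intro!: linearI simp: algebra_simps)
    have u_notin: "\<not> (fst s * fst k \<le> fst s * fst a + \<tau> \<and> snd s * snd k \<le> snd s * snd a + \<tau>)" if "k \<in> K u" for k
      using u(2) that sq by (auto simp: shadow_def distrib_left)
    have u'_notin: "\<not> (fst t * fst k \<le> fst t * fst b + \<tau>' \<and> snd t * snd k \<le> snd t * snd b + \<tau>')" if "k \<in> K' u'" for k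
      using u'(2) that sq by (auto simp: shadow_def distrib_left)
    from st show ?thesis
    proof
      assume "fst s \<noteq> fst t \<and> snd s = snd t"
      then have st: "fst t = - fst s" "snd t = snd s"
        using signs by auto
      show ?thesis
      proof (rule opposite_shadows[OF lin conv])
        show "fst s * fst a + \<tau> < fst s * fst k" if "k \<in> K u" "snd s * snd k \<le> snd s * snd a + \<tau>" for k
          using u_notin[OF that(1)] that(2) by linarith
        show "fst s * fst k < fst s * fst b - \<tau>'" if "k \<in> K' u'" "snd s * snd k \<le> snd s * snd b + \<tau>'" for k
          using u'_notin[OF that(1)] that(2) unfolding st by linarith
      qed (use D close close' str1 str2 u u' \<tau> in \<open>auto simp: abs\<close>)
    next
      assume "fst s = fst t \<and> snd s \<noteq> snd t"
      then have st: "fst t = fst s" "snd t = - snd s"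
        using signs by auto
      show ?thesis
      proof (rule opposite_shadows[OF lin(2,1) conv])
        show "snd s * snd a + \<tau> < snd s * snd k" if "k \<in> K u" "fst s * fst k \<le> fst s * fst a + \<tau>" for k
          using u_notin[OF that(1)] that(2) by linarith
        show "snd s * snd k < snd s * snd b - \<tau>'" if "k \<in> K' u'" "fst s * fst k \<le> fst s * fst b + \<tau>'" for k
          using u'_notin[OF that(1)] that(2) unfolding st by linarith
      qed (use D close close' str1 str2 u u' \<tau> in \<open>auto simp: abs conj_commute\<close>)
    qed
  qed
  note bound = this
  show ?thesis
  proof (rule ccontr)
    assume neg: "\<not> ?thesis"
    define e where "e = min (\<delta> + \<delta>' - (r + D)) (min \<delta> \<delta>') / 3"
    have "0 < e" "e < \<delta>" "e < \<delta>'" "3 * e \<le> \<delta> + \<delta>' - (r + D)"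
      using neg pos by (auto simp: e_def)
    with bound[of "\<delta> - e" "\<delta>' - e"] show False by linarith
  qed
qed

text \<open>In a coordinate with equal signs the entry points differ by at most \<open>D\<close>
  plus the difference of \<open>\<delta>\<close> and \<open>\<delta>'\<close>; with opposite signs,
  by at most \<open>D + \<delta> + \<delta>'\<close>. Both corrections are at most
  \<open>r + D\<close>.\<close>

lemma diagonal_entry_lipschitz:
  assumes x: "diagonal_entry I K a s \<delta>" and y: "diagonal_entry I K' b t \<delta>'"
    and str: "straddles I K a" "straddles I K' b"
    and conv: "\<And>u. u \<in> I \<Longrightarrow> convex (K u) \<and> convex (K' u)"
    and close: "\<And>u k. u \<in> I \<Longrightarrow> k \<in> K' u \<Longrightarrow> \<exists>k'\<in>K u. \<bar>fst k - fst k'\<bar> \<le> r \<and> \<bar>snd k - snd k'\<bar> \<le> r"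
    and close': "\<And>u k. u \<in> I \<Longrightarrow> k \<in> K u \<Longrightarrow> \<exists>k'\<in>K' u. \<bar>fst k - fst k'\<bar> \<le> r \<and> \<bar>snd k - snd k'\<bar> \<le> r"
    and D: "\<bar>fst a - fst b\<bar> \<le> D" "\<bar>snd a - snd b\<bar> \<le> D" and r: "0 \<le> r"
  shows "infnorm ((a + \<delta> *\<^sub>R s) - (b + \<delta>' *\<^sub>R t)) \<le> 2 * D + r"
proof -
  have signs: "s \<in> signs" "t \<in> signs" "0 \<le> \<delta>" "0 \<le> \<delta>'"
    using x y by (auto simp: diagonal_entry_def)
  have D': "\<bar>fst b - fst a\<bar> \<le> D" "\<bar>snd b - snd a\<bar> \<le> D"
    using D by (simp_all add: abs_minus_commute)
  have le: "\<delta> \<le> \<delta>' + r + D" "\<delta>' \<le> \<delta> + r + D"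
    using diagonal_entry_le[OF x y close D r] diagonal_entry_le[OF y x close' D' r] by auto
  have sum: "\<delta> + \<delta>' \<le> r + D" if "s \<noteq> t"
  proof (cases "0 < \<delta> \<and> 0 < \<delta>'")
    case pos: True
    show ?thesis
    proof (cases "t = - s")
      case True
      with diagonal_entry_opposite[OF x y[unfolded True] close D] pos show ?thesis by auto
    next
      case False
      then have "fst s \<noteq> fst t \<and> snd s = snd t \<or> fst s = fst t \<and> snd s \<noteq> snd t"
        using signs \<open>s \<noteq> t\<close> by (auto simp: prod_eq_iff)
      with pos show ?thesis
        by (intro diagonal_entry_adjacent[OF x y str conv close close' D]) auto
    qed
  next
    case False
    then show ?thesis using le signs by auto
  qed
  have coord: "\<bar>(\<alpha> + \<delta> * \<sigma>) - (\<beta> + \<delta>' * \<sigma>')\<bar> \<le> 2 * D + r"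
    if "\<sigma> \<in> {1, -1}" "\<sigma>' \<in> {1, -1}" "\<bar>\<alpha> - \<beta>\<bar> \<le> D" "\<sigma> \<noteq> \<sigma>' \<Longrightarrow> s \<noteq> t" for \<alpha> \<beta> \<sigma> \<sigma>' :: real
    using that le sum signs by (cases "\<sigma> = \<sigma>'") auto
  have "\<bar>fst a + \<delta> * fst s - (fst b + \<delta>' * fst t)\<bar> \<le> 2 * D + r"
    using signs D by (intro coord) auto
  moreover have "\<bar>snd a + \<delta> * snd s - (snd b + \<delta>' * snd t)\<bar> \<le> 2 * D + r"
    using signs D by (intro coord) auto
  ultimately show ?thesis
    using infnorm_plane[of "fst a + \<delta> * fst s - (fst b + \<delta>' * fst t)" "snd a + \<delta> * snd s - (snd b + \<delta>' * snd t)"]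
    by (simp add: minus_prod_def plus_prod_def scaleR_prod_def)
qed

lemma straddles_if_pairwise:
  assumes fin: "finite I"
    and K: "\<And>i. i \<in> I \<Longrightarrow> closed (K i) \<and> convex (K i)"
    and cl: "\<And>i j. i \<in> I \<Longrightarrow> j \<in> I \<Longrightarrow> a \<in> closure (fst ` (K i \<inter> K j)) \<times> closure (snd ` (K i \<inter> K j))"
  shows "straddles I K a"
  unfolding straddles_def
proof (intro allI impI conjI)
  fix \<epsilon> :: real assume \<epsilon>: "\<epsilon> > 0"
  show "\<exists>z\<in>\<Inter>(K ` I). \<bar>fst z - fst a\<bar> < \<epsilon>"
    using cl by (intro inter_meets_lines_near fin K \<epsilon>) (auto simp: mem_Times_iff)
  let ?K = "\<lambda>i. prod.swap -` K i"
  have "closed (?K i) \<and> convex (?K i)" if "i \<in> I" for i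
  proof
    show "closed (?K i)"
      using K[OF that] by (intro closed_vimage continuous_on_swap) auto
    have "prod.swap ((1 - t) *\<^sub>R x + t *\<^sub>R y) = (1 - t) *\<^sub>R prod.swap x + t *\<^sub>R prod.swap y" for t and x y :: "real \<times> real"
      by (simp add: prod_eq_iff)
    then show "convex (?K i)"
      using K[OF that] by (simp add: convex_alt)
  qed
  moreover have "fst ` (?K i \<inter> ?K j) = snd ` (K i \<inter> K j)" for i j
  proof -
    have "?K i \<inter> ?K j = prod.swap ` (K i \<inter> K j)"
      by (auto simp: image_iff intro!: bexI[of _ "prod.swap z" for z])
    then show ?thesis
      by (simp add: image_image)
  qed
  then have "snd a \<in> closure (fst ` (?K i \<inter> ?K j))" if "i \<in> I" "j \<in> I" for i j
    using cl[OF that] by (simp add: mem_Times_iff)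
  ultimately obtain z where "z \<in> \<Inter>(?K ` I)" "\<bar>fst z - snd a\<bar> < \<epsilon>"
    using inter_meets_lines_near[OF fin, of ?K "snd a" \<epsilon>] \<epsilon> by blast
  then show "\<exists>z\<in>\<Inter>(K ` I). \<bar>snd z - snd a\<bar> < \<epsilon>"
    by (intro bexI[of _ "prod.swap z"]) auto
qed

subsection \<open>Neighbourhoods and rectangular hulls\<close>

lemma rectangle_closures:
  assumes "convex S" "S \<noteq> {}"
  shows "rectangle (closure (fst ` S) \<times> closure (snd ` S))"
  unfolding rectangle_def using assms
  by (intro exI[of _ "closure (fst ` S)"] exI[of _ "closure (snd ` S)"])
     (auto simp: is_interval_convex_1 intro!: convex_closure convex_linear_image linear_fst linear_snd)

text \<open>Closures are taken because projections of closed convex sets need not be closed.\<close>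

lemma rectangular_hull_subset_closures:
  assumes "convex S"
  shows "rectangular_hull S \<subseteq> closure (fst ` S) \<times> closure (snd ` S)"
proof (cases "S = {}")
  case False
  have "S \<subseteq> closure (fst ` S) \<times> closure (snd ` S)"
    by (auto simp: mem_Times_iff intro!: subsetD[OF closure_subset] intro: rev_image_eqI)
  with False show ?thesis
    using rectangle_hull_smallest(3)[OF False rectangle_closures[OF assms False]]
    by (simp add: rectangular_hull_def)
qed (simp add: rectangular_hull_def)

lemma mem_scaled_square:
  assumes "0 \<le> l"
  shows "p \<in> scaled_square l r \<longleftrightarrow>
    r = \<infinity> \<or> \<bar>fst p\<bar> \<le> l * enn2real r \<and> \<bar>snd p\<bar> \<le> l * enn2real r"
proof (cases "r = \<infinity>")
  case False
  define c where "c = l * enn2real r"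
  have c: "0 \<le> c"
    using assms by (simp add: c_def)
  have "p \<in> (\<lambda>p. c *\<^sub>R p) ` unit_square \<longleftrightarrow> \<bar>fst p\<bar> \<le> c \<and> \<bar>snd p\<bar> \<le> c"
  proof
    assume "p \<in> (\<lambda>p. c *\<^sub>R p) ` unit_square"
    then obtain q where q: "p = c *\<^sub>R q" "q \<in> unit_square"
      by blast
    then have "\<bar>fst q\<bar> \<le> 1" "\<bar>snd q\<bar> \<le> 1"
      by (auto simp: unit_square_def mem_Times_iff)
    with c q(1) show "\<bar>fst p\<bar> \<le> c \<and> \<bar>snd p\<bar> \<le> c"
      by (simp add: abs_mult mult_left_le)
  next
    assume p: "\<bar>fst p\<bar> \<le> c \<and> \<bar>snd p\<bar> \<le> c"
    show "p \<in> (\<lambda>p. c *\<^sub>R p) ` unit_square"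
    proof (cases "c = 0")
      case True
      with p show ?thesis
        by (intro image_eqI[of _ _ 0]) (auto simp: unit_square_def prod_eq_iff zero_prod_def)
    next
      case False
      with p c show ?thesis
        by (intro image_eqI[of _ _ "(1 / c) *\<^sub>R p"])
           (auto simp: unit_square_def mem_Times_iff abs_le_iff field_simps)
    qed
  qed
  with False show ?thesis
    by (simp add: scaled_square_def c_def)
qed (simp add: scaled_square_def)

lemma mem_plus_scaled_square:
  assumes "0 \<le> l"
  shows "k \<in> A + scaled_square l r \<longleftrightarrow>
    (\<exists>x\<in>A. r = \<infinity> \<or> \<bar>fst k - fst x\<bar> \<le> l * enn2real r \<and> \<bar>snd k - snd x\<bar> \<le> l * enn2real r)"
proof -
  have "k \<in> A + scaled_square l r \<longleftrightarrow> (\<exists>x\<in>A. k - x \<in> scaled_square l r)"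
    by (force simp: set_plus_def algebra_simps)
  then show ?thesis
    by (simp add: mem_scaled_square[OF assms])
qed

lemma closed_convex_plus_scaled_square:
  assumes "closed A" "convex A"
  shows "closed (A + scaled_square l r) \<and> convex (A + scaled_square l r)"
proof
  have cc: "compact unit_square" "convex unit_square"
    by (auto simp: unit_square_def intro!: compact_Times convex_Times)
  have "convex (scaled_square l r)"
    using cc by (auto simp: scaled_square_def intro: convex_scaling)
  with assms show "convex (A + scaled_square l r)"
    by (intro convex_set_plus)
  show "closed (A + scaled_square l r)"
  proof (cases "r = \<infinity>")
    case True
    have "A + UNIV = (if A = {} then {} else UNIV)"
    proof -
      have "z \<in> A + UNIV" if "x \<in> A" for x z
        using set_plus_intro[OF that UNIV_I, of "z - x"] by simp
      then show ?thesis by (auto simp: set_plus_def)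
    qed
    with True show ?thesis by (simp add: scaled_square_def)
  next
    case False
    then have "compact (scaled_square l r)"
      using cc by (auto simp: scaled_square_def intro: compact_scaling)
    moreover have "A + scaled_square l r = (\<Union>x\<in>A. \<Union>y\<in>scaled_square l r. {x + y})"
      by (auto simp: set_plus_def)
    ultimately show ?thesis
      using closed_compact_sums[OF assms(1)] by simp
  qed
qed

lemma clamp_close:
  fixes x k :: real
  assumes "\<bar>k - x\<bar> \<le> c" "c \<le> c' + r" "0 \<le> r" "0 \<le> c'"
  shows "\<exists>k'. \<bar>k' - x\<bar> \<le> c' \<and> \<bar>k - k'\<bar> \<le> r"
  using assms by (intro exI[of _ "max (x - c') (min (x + c') k)"]) auto

text \<open>Think of \<open>q\<close> and \<open>q'\<close> as the distances of one point from two
  others, which are \<open>p\<close> apart. The same point of \<open>A\<close> serves for both sets,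
  and \<open>k'\<close> is \<open>k\<close> clamped to the other square around it.\<close>

lemma plus_scaled_square_close:
  assumes l: "0 \<le> l" and p: "p \<noteq> \<infinity>" and tri: "q' \<le> q + p" "q \<le> q' + p"
    and k: "k \<in> A + scaled_square l q'"
  shows "\<exists>k'\<in>A + scaled_square l q. \<bar>fst k - fst k'\<bar> \<le> l * enn2real p \<and> \<bar>snd k - snd k'\<bar> \<le> l * enn2real p"
proof (cases "q = \<infinity>")
  case True
  with k l show ?thesis
    by (intro bexI[of _ k]) (auto simp: mem_plus_scaled_square)
next
  case False
  with p tri(1) have q': "q' \<noteq> \<infinity>"
    by (metis ennreal_add_eq_top infinity_ennreal_def top.extremum_unique)
  then obtain x where x: "x \<in> A" "\<bar>fst k - fst x\<bar> \<le> l * enn2real q'" "\<bar>snd k - snd x\<bar> \<le> l * enn2real q'"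
    using k l by (auto simp: mem_plus_scaled_square)
  have "enn2real q' \<le> enn2real (q + p)"
    using tri(1) False p by (intro enn2real_mono) (auto simp: less_top)
  also have "\<dots> = enn2real q + enn2real p"
    using False p by (intro enn2real_plus) (auto simp: less_top)
  finally have le: "l * enn2real q' \<le> l * enn2real q + l * enn2real p"
    using l by (simp add: mult_left_mono flip: distrib_left)
  obtain k1 where k1: "\<bar>k1 - fst x\<bar> \<le> l * enn2real q" "\<bar>fst k - k1\<bar> \<le> l * enn2real p"
    using clamp_close[OF x(2) le] l by auto
  obtain k2 where k2: "\<bar>k2 - snd x\<bar> \<le> l * enn2real q" "\<bar>snd k - k2\<bar> \<le> l * enn2real p"
    using clamp_close[OF x(3) le] l by auto
  have "(k1, k2) \<in> A + scaled_square l q"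
    unfolding mem_plus_scaled_square[OF l] using x(1) k1 k2 by auto
  with k1 k2 show ?thesis
    by (intro bexI[of _ "(k1, k2)"]) auto
qed

section \<open>Assembling the selection\<close>

theorem theorem1p10:
  fixes M :: "'a set"
    and \<rho> :: "'a \<Rightarrow> 'a \<Rightarrow> ennreal"
    and F :: "'a \<Rightarrow> (real \<times> real) set"
    and lamt lam :: real
  assumes "finite M" and "pseudometric_on M \<rho>"
    and "\<And>x. x \<in> M \<Longrightarrow> F x \<noteq> {} \<and> convex (F x) \<and> closed (F x)"
    and "0 \<le> lamt" and "0 \<le> lam"
    and "\<And>x x' x'' y y' y''.
      \<lbrakk>x \<in> M; x' \<in> M; x'' \<in> M; y \<in> M; y' \<in> M; y'' \<in> M\<rbrakk> \<Longrightarrow>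
      W \<rho> F lamt x x' x'' \<inter> (W \<rho> F lamt y y' y'' + scaled_square lam (\<rho> x y)) \<noteq> {}"
  shows "\<exists>f. lipschitz_selection M \<rho> F f \<and> lip_seminorm M \<rho> f \<le> ennreal (2 * lam + lamt)"
proof -
  note lamt = assms(4) and lam = assms(5)
  have \<rho>_refl: "\<rho> x x = 0" if "x \<in> M" for x
    using assms(2) that by (auto simp: pseudometric_on_def)
  have \<rho>_sym: "\<rho> x y = \<rho> y x" if "x \<in> M" "y \<in> M" for x y
    using assms(2) that by (auto simp: pseudometric_on_def)
  have \<rho>_tri: "\<rho> x y \<le> \<rho> x z + \<rho> z y" if "x \<in> M" "y \<in> M" "z \<in> M" for x y z
    using assms(2) that by (auto simp: pseudometric_on_def)
  have \<rho>_tri_real: "\<rho> x y \<noteq> \<infinity> \<and> enn2real (\<rho> x y) \<le> enn2real (\<rho> x z) + enn2real (\<rho> z y)"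
    if "x \<in> M" "y \<in> M" "z \<in> M" "\<rho> x z \<noteq> \<infinity>" "\<rho> z y \<noteq> \<infinity>" for x y z
  proof -
    have fin: "\<rho> x z < top" "\<rho> z y < top"
      using that by (auto simp: less_top)
    then have "\<rho> x z + \<rho> z y < top" by simp
    with \<rho>_tri[OF that(1-3)] have "enn2real (\<rho> x y) \<le> enn2real (\<rho> x z + \<rho> z y)" "\<rho> x y < top"
      by (auto intro: enn2real_mono le_less_trans)
    with fin show ?thesis
      by (simp add: enn2real_plus less_top)
  qed
  define K where "K x u = F u + scaled_square lamt (\<rho> u x)" for x u
  have K: "closed (K x u) \<and> convex (K x u)" if "u \<in> M" for x u
    unfolding K_def using assms(3)[OF that] by (intro closed_convex_plus_scaled_square) auto
  define P where "P x u v = closure (fst ` (K x u \<inter> K x v))" for x u v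
  define Q where "Q x u v = closure (snd ` (K x u \<inter> K x v))" for x u v
  have K2: "convex (K x u \<inter> K x v)" if "u \<in> M" "v \<in> M" for x u v
    using K that by (auto intro: convex_Int)
  have W_sub: "W \<rho> F lamt x u v \<subseteq> P x u v \<times> Q x u v" if "u \<in> M" "v \<in> M" for x u v
    unfolding W_def P_def Q_def K_def[symmetric]
    by (rule rectangular_hull_subset_closures[OF K2[OF that]])
  have PQ: "convex (P x u v)" "convex (Q x u v)" if "u \<in> M" "v \<in> M" for x u v
    unfolding P_def Q_def using K2[OF that]
    by (auto intro!: convex_closure convex_linear_image linear_fst linear_snd)
  \<comment> \<open>Each triple \<open>(x, u, v)\<close> indexes one interval, but distances see
    only the first component. Triples over the same \<open>x\<close> are thus at distance 0 and
    receive the same value.\<close>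
  let ?A = "M \<times> M \<times> M" and ?E = "\<lambda>i j. \<rho> (fst i) (fst j) \<noteq> \<infinity>"
    and ?d = "\<lambda>i j. lam * enn2real (\<rho> (fst i) (fst j))"
  have meet: "\<exists>p\<in>P x u v \<times> Q x u v. \<exists>q\<in>P y u' v' \<times> Q y u' v'. \<rho> x y \<noteq> \<infinity> \<longrightarrow>
      \<bar>fst p - fst q\<bar> \<le> lam * enn2real (\<rho> x y) \<and> \<bar>snd p - snd q\<bar> \<le> lam * enn2real (\<rho> x y)"
    if M: "x \<in> M" "u \<in> M" "v \<in> M" "y \<in> M" "u' \<in> M" "v' \<in> M" for x u v y u' v'
  proof -
    obtain p where p: "p \<in> W \<rho> F lamt x u v" "p \<in> W \<rho> F lamt y u' v' + scaled_square lam (\<rho> x y)"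
      using assms(6)[OF M] by blast
    obtain q where "q \<in> W \<rho> F lamt y u' v'" "\<rho> x y \<noteq> \<infinity> \<longrightarrow>
        \<bar>fst p - fst q\<bar> \<le> lam * enn2real (\<rho> x y) \<and> \<bar>snd p - snd q\<bar> \<le> lam * enn2real (\<rho> x y)"
      using p(2) unfolding mem_plus_scaled_square[OF lam] by blast
    with p(1) W_sub M show ?thesis
      by (meson subsetD)
  qed
  have selection: "\<exists>g. (\<forall>x\<in>M. \<forall>u\<in>M. \<forall>v\<in>M. g x \<in> R x u v) \<and>
      (\<forall>x\<in>M. \<forall>y\<in>M. \<rho> x y \<noteq> \<infinity> \<longrightarrow> \<bar>g x - g y\<bar> \<le> lam * enn2real (\<rho> x y))"
    if R: "\<And>x u v. u \<in> M \<Longrightarrow> v \<in> M \<Longrightarrow> convex (R x u v)"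
      and meet: "\<And>x u v y u' v'. \<lbrakk>x \<in> M; u \<in> M; v \<in> M; y \<in> M; u' \<in> M; v' \<in> M\<rbrakk> \<Longrightarrow>
        \<exists>p\<in>R x u v. \<exists>q\<in>R y u' v'. \<rho> x y \<noteq> \<infinity> \<longrightarrow> \<bar>p - q\<bar> \<le> lam * enn2real (\<rho> x y)"
    for R :: "'a \<Rightarrow> 'a \<Rightarrow> 'a \<Rightarrow> real set"
  proof -
    have "\<exists>g. (\<forall>i\<in>?A. g i \<in> (case i of (x, u, v) \<Rightarrow> R x u v)) \<and>
        (\<forall>i\<in>?A. \<forall>j\<in>?A. ?E i j \<longrightarrow> \<bar>g i - g j\<bar> \<le> ?d i j)"
    proof (rule interval_selection)
      show "?E i k \<and> ?d i k \<le> ?d i j + ?d j k"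
        if "i \<in> ?A" "j \<in> ?A" "k \<in> ?A" "?E i j" "?E j k" for i j k
        using \<rho>_tri_real[of "fst i" "fst k" "fst j"] that lam
        by (auto simp: mult_left_mono simp flip: distrib_left)
      show "\<exists>p\<in>(case i of (x, u, v) \<Rightarrow> R x u v). \<exists>q\<in>(case j of (x, u, v) \<Rightarrow> R x u v). ?E i j \<longrightarrow> \<bar>p - q\<bar> \<le> ?d i j"
        if "i \<in> ?A" "j \<in> ?A" for i j
        using that meet by (auto simp: case_prod_beta mem_Times_iff)
      show "?E j i \<and> ?d j i = ?d i j" if "i \<in> ?A" "j \<in> ?A" "?E i j" for i j
        using \<rho>_sym[of "fst i" "fst j"] that by (auto simp: mem_Times_iff)
    qed (use assms(1) R \<rho>_refl in \<open>auto simp: case_prod_beta mem_Times_iff\<close>)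
    then obtain g where g0: "\<forall>i\<in>?A. g i \<in> (case i of (x, u, v) \<Rightarrow> R x u v)"
        and g1: "\<And>i j. \<lbrakk>i \<in> ?A; j \<in> ?A; ?E i j\<rbrakk> \<Longrightarrow> \<bar>g i - g j\<bar> \<le> ?d i j"
      by blast
    have g: "g (x, u, v) \<in> R x u v" if "x \<in> M" "u \<in> M" "v \<in> M" for x u v
      using bspec[OF g0, of "(x, u, v)"] that by simp
    \<comment> \<open>The common value over \<open>x\<close> lies in every interval belonging to
      \<open>x\<close>; the triple \<open>(x, x, x)\<close> merely represents it.\<close>
    have "g (x, x, x) \<in> R x u v" if "x \<in> M" "u \<in> M" "v \<in> M" for x u v
    proof -
      have "\<bar>g (x, x, x) - g (x, u, v)\<bar> \<le> 0"
        using g1[of "(x, x, x)" "(x, u, v)"] \<rho>_refl that by simp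
      with g[OF that] show ?thesis by simp
    qed
    moreover have "\<bar>g (x, x, x) - g (y, y, y)\<bar> \<le> lam * enn2real (\<rho> x y)"
      if "x \<in> M" "y \<in> M" "\<rho> x y \<noteq> \<infinity>" for x y
      using g1[of "(x, x, x)" "(y, y, y)"] that by simp
    ultimately show ?thesis
      by (intro exI[of _ "\<lambda>x. g (x, x, x)"]) blast
  qed
  obtain g1 where g1: "\<And>x u v. \<lbrakk>x \<in> M; u \<in> M; v \<in> M\<rbrakk> \<Longrightarrow> g1 x \<in> P x u v"
      "\<And>x y. \<lbrakk>x \<in> M; y \<in> M; \<rho> x y \<noteq> \<infinity>\<rbrakk> \<Longrightarrow> \<bar>g1 x - g1 y\<bar> \<le> lam * enn2real (\<rho> x y)"
  proof -
    have "\<exists>p\<in>P x u v. \<exists>q\<in>P y u' v'. \<rho> x y \<noteq> \<infinity> \<longrightarrow> \<bar>p - q\<bar> \<le> lam * enn2real (\<rho> x y)"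
      if "x \<in> M" "u \<in> M" "v \<in> M" "y \<in> M" "u' \<in> M" "v' \<in> M" for x u v y u' v'
      using meet[OF that] by (auto simp: mem_Times_iff)
    from selection[of P, OF PQ(1) this] that show thesis by blast
  qed
  obtain g2 where g2: "\<And>x u v. \<lbrakk>x \<in> M; u \<in> M; v \<in> M\<rbrakk> \<Longrightarrow> g2 x \<in> Q x u v"
      "\<And>x y. \<lbrakk>x \<in> M; y \<in> M; \<rho> x y \<noteq> \<infinity>\<rbrakk> \<Longrightarrow> \<bar>g2 x - g2 y\<bar> \<le> lam * enn2real (\<rho> x y)"
  proof -
    have "\<exists>p\<in>Q x u v. \<exists>q\<in>Q y u' v'. \<rho> x y \<noteq> \<infinity> \<longrightarrow> \<bar>p - q\<bar> \<le> lam * enn2real (\<rho> x y)"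
      if "x \<in> M" "u \<in> M" "v \<in> M" "y \<in> M" "u' \<in> M" "v' \<in> M" for x u v y u' v'
      using meet[OF that] by (auto simp: mem_Times_iff)
    from selection[of Q, OF PQ(2) this] that show thesis by blast
  qed
  define a where "a x = (g1 x, g2 x)" for x
  have str: "straddles M (K x) (a x)" if "x \<in> M" for x
    using g1(1) g2(1) that K assms(1)
    by (intro straddles_if_pairwise) (auto simp: a_def P_def Q_def)
  have "\<forall>x\<in>M. \<exists>s \<delta>. diagonal_entry M (K x) (a x) s \<delta>"
    using diagonal_entry_exists[OF K str] by blast
  then obtain s \<delta> where entry: "\<And>x. x \<in> M \<Longrightarrow> diagonal_entry M (K x) (a x) (s x) (\<delta> x)"
    by metis
  define f where "f x = a x + \<delta> x *\<^sub>R s x" for x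
  have f_in: "f x \<in> F x" if x: "x \<in> M" for x
  proof -
    \<comment> \<open>Since \<open>\<rho> x x = 0\<close>, the enlarged set \<open>K x x\<close> is
      \<open>F x\<close> itself.\<close>
    have "f x \<in> K x x"
      using entry[OF x] x by (auto simp: diagonal_entry_def f_def)
    then obtain p where "p \<in> F x" "fst (f x) = fst p" "snd (f x) = snd p"
      using \<rho>_refl[OF x] by (auto simp: K_def mem_plus_scaled_square[OF lamt])
    then show ?thesis
      by (metis prod_eqI)
  qed
  have close: "\<exists>k'\<in>K x u. \<bar>fst k - fst k'\<bar> \<le> lamt * enn2real (\<rho> x y) \<and> \<bar>snd k - snd k'\<bar> \<le> lamt * enn2real (\<rho> x y)"
    if "x \<in> M" "y \<in> M" "\<rho> x y \<noteq> \<infinity>" "u \<in> M" "k \<in> K y u" for x y u k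
  proof -
    have "\<rho> u y \<le> \<rho> u x + \<rho> x y" "\<rho> u x \<le> \<rho> u y + \<rho> x y"
      using \<rho>_tri[of u y x] \<rho>_tri[of u x y] \<rho>_sym[of y x] that(1,2,4) by simp_all
    from plus_scaled_square_close[OF lamt that(3) this that(5)[unfolded K_def]]
    show ?thesis by (simp add: K_def)
  qed
  have lip: "infnorm (f x - f y) \<le> (2 * lam + lamt) * enn2real (\<rho> x y)"
    if xy: "x \<in> M" "y \<in> M" "\<rho> x y \<noteq> \<infinity>" for x y
  proof -
    have yx: "\<rho> y x \<noteq> \<infinity>" "\<rho> y x = \<rho> x y"
      using xy \<rho>_sym by auto
    \<comment> \<open>The selection \<open>a\<close> moves by at most
      \<open>D = lam * enn2real (\<rho> x y)\<close> in each coordinate, and the sets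
      \<open>K x u\<close> by at most \<open>r = lamt * enn2real (\<rho> x y)\<close>.\<close>
    have "infnorm (f x - f y) \<le> 2 * (lam * enn2real (\<rho> x y)) + lamt * enn2real (\<rho> x y)"
      unfolding f_def
    proof (rule diagonal_entry_lipschitz[OF entry[OF xy(1)] entry[OF xy(2)] str[OF xy(1)] str[OF xy(2)]])
      show "\<exists>k'\<in>K y u. \<bar>fst k - fst k'\<bar> \<le> lamt * enn2real (\<rho> x y) \<and> \<bar>snd k - snd k'\<bar> \<le> lamt * enn2real (\<rho> x y)"
        if "u \<in> M" "k \<in> K x u" for u k
        using close[OF xy(2,1) yx(1) that] yx(2) by simp
    qed (use K close[OF xy] g1(2)[OF xy] g2(2)[OF xy] lamt in \<open>auto simp: a_def\<close>)
    then show ?thesis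
      by (simp add: algebra_simps)
  qed
  have "lip_seminorm M \<rho> f \<le> ennreal (2 * lam + lamt)"
    unfolding lip_seminorm_def using lip lam lamt
    by (intro Inf_lower CollectI exI[of _ "2 * lam + lamt"]) simp
  moreover from this have "lipschitz_selection M \<rho> F f"
    using f_in by (auto simp: lipschitz_selection_def intro: le_less_trans)
  ultimately show ?thesis by blast
qed

end
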